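(* Let $\eta\in\Omega_{<\infty}$ and let $\mathbf J=(J_k)_{k\in\mathbb N}$, $J_k=(J_{k,j})_j$, be the rigging associated with $\eta$ by the KKR bijection. Then for any $k\in\mathbb N$ and $i\in\mathbb Z_{\ge0}$, $$\tilde\zeta_k(i)=\left|\{j\in\mathbb N\ ;\ J_{k,j}=i-k\}\right|.$$
   Context: $\mathbb N=\{1,2,\dots\}$, $\Omega=\{0,1\}^{\mathbb N}$, $\Omega_{<\infty}=\{\eta\in\Omega\ ;\ \sum_{x\in\mathbb N}\eta(x)<\infty\}$. Kerov-Kirillov-Reshetikhin (KKR) construction: from $\eta$ one builds, for $x=0,1,2,\dots$, a partition $\mu(x)=(\mu_1(x)\ge\mu_2(x)\ge\cdots\ge0)$ together with a rigging $\mathbf J(x)=(J_k(x))_{k\in\mathbb N}$, where $J_k(x)=(J_{k,1}(x)\le\cdots\le J_{k,m_k(x)}(x))$ is a weakly increasing array of integers and $m_k(x)$ is the multiplicity of $k$ in $\mu(x)$ ($J_k(x)=\varnothing$ if $m_k(x)=0$). Let $E_k(x)=\sum_{i\in\mathbb N}\min\{\mu_i(x),k\}$ and $p_k(x)=x-2E_k(x)$. A row of $\mu(x)$ of length $k\ge1$ is singular if $p_k(x)=J_{k,m_k(x)}(x)$. Start with $\mu(0)=\varnothing$, $\mathbf J(0)=\varnothing$. Given $(\mu(x),\mathbf J(x))$: - if $\eta(x+1)=0$, set $(\mu(x+1),\mathbf J(x+1))=(\mu(x),\mathbf J(x))$; - if $\eta(x+1)=1$ and there is a singular row, let $k$ be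 the maximal length of a singular row; replace one row of length $k$ by a row of length $k+1$ to get $\mu(x+1)$, remove the largest entry $J_{k,m_k(x)}(x)$ from $J_k(x)$, and insert $p_{k+1}(x+1)$ (computed with $\mu(x+1)$) into $J_{k+1}(x)$, keeping the array weakly increasing; all other arrays are unchanged; - if $\eta(x+1)=1$ and there is no singular row, add a row of length $1$ to $\mu(x)$ to get $\mu(x+1)$ and insert $p_1(x+1)$ into $J_1(x)$, keeping the array weakly increasing; other arrays are unchanged. For $\eta\in\Omega_{<\infty}$ the sequence $(\mu(x),\mathbf J(x))$ is eventually constant in $x$; its limit $(\mu,\mathbf J)$ is the rigged configuration of $\eta$. The index $j$ of $J_{k,j}$ ranges over $1\le j\le m_k$, with $m_k$ the multiplicity of $k$ in $\mu$. Records: let $W_\infty(0)=0$, $W_\infty(x)=W_\infty(x-1)+\eta(x)-\min\{1-\eta(x),W_\infty(x-1)\}$; a site $x\in\mathbb N$ is a record if $W_\infty(x-1)=W_\infty(x)=0$. Takahashi-Satsuma (TS) algorithm for $\eta\in\Omega_{<\infty}$: a run is a maximal string of consecutive equal letters; the configuration is regarded as preceded by infinitely many $0$'s to the left of site $1$ (so the leading run of $0$'s is infinite). While there are uncrossed $1$'s: considering only uncrossed letters, select the leftmost run whose length is at least the length, denoted $k$, of the run preceding it; the first $k$ letters of this run together with the last $k$ letters of the preceding run form a $k$-soliton; cross out these $2k$ letters. A $k$-soliton is thus a set $\gamma=\{z(\gamma)_1<\cdots<z(\gamma)_{2k}\}\subset\mathbb N$. Every site of $\mathbb N$ is either a record or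 a component of exactly one soliton. Slot configuration: $\nu:\mathbb N\to\mathbb Z_{\ge0}\cup\{\infty\}$ is $\nu(x)=l-1$ if $x=z(\gamma)_l$ or $x=z(\gamma)_{l+k}$ for some $k$-soliton $\gamma$ of $\eta$ and $1\le l\le k$, and $\nu(x)=\infty$ if $x$ is a record. Put $\tilde\xi_k(0)=0$, $\tilde\xi_k(x)=\sum_{y=1}^x\mathbf 1_{\{\nu(y)\ge k\}}$, $\tilde s_k(i)=\min\{x\in\mathbb Z_{\ge0}\ ;\ \tilde\xi_k(x)=i\}$. Slot decomposition: for $k\in\mathbb N$, $i\in\mathbb Z_{\ge0}$, $\tilde\zeta_k(i)$ is the number of $k$-solitons $\gamma$ of $\eta$ with $\gamma\subset[\tilde s_k(i),\tilde s_k(i+1)-1]$. *)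

theory Defs
  imports Complex_Main "HOL-Library.Multiset" "HOL-Library.Extended_Nat" "HOL-Library.FuncSet"
begin

section \<open>Configurations\<close>

text \<open>Sites are the positive naturals. A configuration is a function on \<^typ>\<open>nat\<close>; its value
  at the non-site \<open>0\<close> is arbitrary and is never used below.\<close>

definition Omega :: "(nat \<Rightarrow> nat) set" where
  "Omega = {1..} \<rightarrow> {0, 1}"

definition Omega_fin :: "(nat \<Rightarrow> nat) set" where
  "Omega_fin = {\<eta> \<in> Omega. summable (\<lambda>n. real (\<eta> (Suc n)))}"

section \<open>Rigged configurations\<close>

text \<open>A partition is the multiset of its nonzero rows, so \<open>m\<^sub>k\<close> is \<open>count \<mu> k\<close>. A rigging maps each
  \<open>k \<ge> 1\<close> to the weakly increasing list \<open>J\<^sub>k\<close>, of length \<open>m\<^sub>k\<close>; \<open>rig J k j\<close> is \<open>J\<^bsub>k,j\<^esub>\<close>, with \<open>j\<close>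
  counted from 1.\<close>

type_synonym rigging = "nat \<Rightarrow> int list"
type_synonym rigged_configuration = "nat multiset \<times> rigging"

definition rig :: "rigging \<Rightarrow> nat \<Rightarrow> nat \<Rightarrow> int" where
  "rig J k j = J k ! (j - 1)"

definition energy :: "nat multiset \<Rightarrow> nat \<Rightarrow> nat" where
  "energy \<mu> k = (\<Sum>r\<in>#\<mu>. min r k)"

definition vacancy :: "nat \<Rightarrow> nat multiset \<Rightarrow> nat \<Rightarrow> int" where
  "vacancy x \<mu> k = int x - 2 * int (energy \<mu> k)"

definition singular_lengths :: "nat \<Rightarrow> rigged_configuration \<Rightarrow> nat set" where
  "singular_lengths x = (\<lambda>(\<mu>, J). {k. k \<in># \<mu> \<and> vacancy x \<mu> k = rig J k (count \<mu> k)})"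

text \<open>The update at site \<open>x + 1\<close> when \<open>\<eta>(x + 1) = 1\<close>.\<close>

definition kkr_step :: "nat \<Rightarrow> rigged_configuration \<Rightarrow> rigged_configuration" where
  "kkr_step x = (\<lambda>(\<mu>, J).
     if singular_lengths x (\<mu>, J) \<noteq> {} then
       (let k = Max (singular_lengths x (\<mu>, J));
            \<mu>' = add_mset (k + 1) (\<mu> - {#k#})
        in (\<mu>', J(k := butlast (J k),
                   k + 1 := insort (vacancy (x + 1) \<mu>' (k + 1)) (J (k + 1)))))
     else
       (let \<mu>' = add_mset 1 \<mu>
        in (\<mu>', J(1 := insort (vacancy (x + 1) \<mu>' 1) (J 1)))))"

primrec kkr :: "(nat \<Rightarrow> nat) \<Rightarrow> nat \<Rightarrow> rigged_configuration" where
  "kkr \<eta> 0 = ({#}, \<lambda>_. [])"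
| "kkr \<eta> (Suc x) = (if \<eta> (Suc x) = 1 then kkr_step x (kkr \<eta> x) else kkr \<eta> x)"

definition kkr_limit :: "(nat \<Rightarrow> nat) \<Rightarrow> rigged_configuration" where
  "kkr_limit \<eta> = (THE c. eventually (\<lambda>x. kkr \<eta> x = c) sequentially)"

lemma kkr_eventually_limit:
  assumes "\<eta> \<in> Omega_fin"
  shows "eventually (\<lambda>x. kkr \<eta> x = kkr_limit \<eta>) sequentially"
proof -
  have "(\<lambda>n. real (\<eta> (Suc n))) \<longlonglongrightarrow> 0"
    using assms unfolding Omega_fin_def by (intro summable_LIMSEQ_zero) simp
  then have "eventually (\<lambda>n. real (\<eta> (Suc n)) < 1) sequentially"
    by (rule order_tendstoD) simp
  then obtain N where N: "\<And>n. n \<ge> N \<Longrightarrow> real (\<eta> (Suc n)) < 1"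
    by (auto simp: eventually_sequentially)
  have const: "kkr \<eta> x = kkr \<eta> N" if "x \<ge> N" for x
    using that
  proof (induction x rule: dec_induct)
    case (step n)
    have "\<eta> (Suc n) \<noteq> 1" using N[OF step(1)] by linarith
    with step show ?case by simp
  qed simp
  have ev: "eventually (\<lambda>x. kkr \<eta> x = kkr \<eta> N) sequentially"
    unfolding eventually_sequentially using const by blast
  have "kkr_limit \<eta> = kkr \<eta> N"
    unfolding kkr_limit_def
  proof (rule the_equality)
    show "eventually (\<lambda>x. kkr \<eta> x = kkr \<eta> N) sequentially" by (rule ev)
  next
    fix c assume "eventually (\<lambda>x. kkr \<eta> x = c) sequentially"
    with ev have "eventually (\<lambda>x::nat. kkr \<eta> N = c) sequentially"
      by eventually_elim simp
    then show "c = kkr \<eta> N" by simp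
  qed
  with ev show ?thesis by simp
qed

section \<open>Records\<close>

primrec carrier_load :: "(nat \<Rightarrow> nat) \<Rightarrow> nat \<Rightarrow> nat" where
  "carrier_load \<eta> 0 = 0"
| "carrier_load \<eta> (Suc x) =
     carrier_load \<eta> x + \<eta> (Suc x) - min (1 - \<eta> (Suc x)) (carrier_load \<eta> x)"

definition record_site :: "(nat \<Rightarrow> nat) \<Rightarrow> nat \<Rightarrow> bool" where
  "record_site \<eta> x \<longleftrightarrow> x \<ge> 1 \<and> carrier_load \<eta> (x - 1) = 0 \<and> carrier_load \<eta> x = 0"

section \<open>The Takahashi--Satsuma algorithm\<close>

text \<open>The algorithm runs on the two-sided word \<open>w\<close> obtained by putting \<open>0\<close> at all sites \<open>\<le> 0\<close>.
  \<open>U\<close> denotes the set of uncrossed sites.\<close>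

definition two_sided :: "(nat \<Rightarrow> nat) \<Rightarrow> int \<Rightarrow> nat" where
  "two_sided \<eta> y = (if y \<ge> 1 then \<eta> (nat y) else 0)"

definition equal_string :: "(int \<Rightarrow> nat) \<Rightarrow> int set \<Rightarrow> int set \<Rightarrow> bool" where
  "equal_string w U S \<longleftrightarrow> S \<noteq> {} \<and> S \<subseteq> U \<and>
     (\<forall>a\<in>S. \<forall>b\<in>S. {a..b} \<inter> U \<subseteq> S) \<and> (\<exists>c. \<forall>y\<in>S. w y = c)"

definition run :: "(int \<Rightarrow> nat) \<Rightarrow> int set \<Rightarrow> int set \<Rightarrow> bool" where
  "run w U R \<longleftrightarrow> equal_string w U R \<and> (\<forall>S. equal_string w U S \<and> R \<subseteq> S \<longrightarrow> S = R)"

definition run_length :: "int set \<Rightarrow> enat" where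
  "run_length R = (if finite R then enat (card R) else \<infinity>)"

text \<open>\<open>P\<close> is the run immediately preceding the run \<open>R\<close>.\<close>

definition preceding_run :: "(int \<Rightarrow> nat) \<Rightarrow> int set \<Rightarrow> int set \<Rightarrow> int set \<Rightarrow> bool" where
  "preceding_run w U P R \<longleftrightarrow> run w U P \<and> run w U R \<and>
     (\<forall>p\<in>P. \<forall>r\<in>R. p < r \<and> {p..r} \<inter> U \<subseteq> P \<union> R)"

definition eligible_run :: "(int \<Rightarrow> nat) \<Rightarrow> int set \<Rightarrow> int set \<Rightarrow> int set \<Rightarrow> bool" where
  "eligible_run w U P R \<longleftrightarrow> preceding_run w U P R \<and> run_length P \<le> run_length R"

definition selected_run :: "(int \<Rightarrow> nat) \<Rightarrow> int set \<Rightarrow> int set \<Rightarrow> int set \<Rightarrow> bool" where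
  "selected_run w U P R \<longleftrightarrow> eligible_run w U P R \<and>
     (\<forall>P' R'. eligible_run w U P' R' \<longrightarrow> R' = R \<or> (\<forall>r\<in>R. \<forall>r'\<in>R'. r < r'))"

definition first_letters :: "nat \<Rightarrow> int set \<Rightarrow> int set" where
  "first_letters k R = {r \<in> R. finite {s \<in> R. s < r} \<and> card {s \<in> R. s < r} < k}"

definition last_letters :: "nat \<Rightarrow> int set \<Rightarrow> int set" where
  "last_letters k P = {p \<in> P. finite {q \<in> P. p < q} \<and> card {q \<in> P. p < q} < k}"

text \<open>One round of the algorithm: with \<open>U\<close> uncrossed, the letters in \<open>G\<close> form a \<open>k\<close>-soliton.\<close>

definition ts_round :: "(int \<Rightarrow> nat) \<Rightarrow> int set \<Rightarrow> nat \<Rightarrow> int set \<Rightarrow> bool" where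
  "ts_round w U k G \<longleftrightarrow> (\<exists>u\<in>U. w u = 1) \<and>
     (\<exists>P R. selected_run w U P R \<and> run_length P = enat k \<and>
            G = last_letters k P \<union> first_letters k R)"

text \<open>The sets of uncrossed sites that occur in the course of the algorithm.\<close>

inductive ts_uncrossed :: "(int \<Rightarrow> nat) \<Rightarrow> int set \<Rightarrow> bool" for w where
  start: "ts_uncrossed w UNIV"
| cross: "ts_uncrossed w U \<Longrightarrow> ts_round w U k G \<Longrightarrow> ts_uncrossed w (U - G)"

definition soliton :: "(nat \<Rightarrow> nat) \<Rightarrow> nat \<Rightarrow> nat set \<Rightarrow> bool" where
  "soliton \<eta> k \<gamma> \<longleftrightarrow>
     (\<exists>U. ts_uncrossed (two_sided \<eta>) U \<and> ts_round (two_sided \<eta>) U k (int ` \<gamma>))"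

text \<open>\<open>component \<gamma> l\<close> is the \<open>l\<close>-th smallest element of \<open>\<gamma>\<close>, with \<open>l\<close> counted from 1.\<close>

definition component :: "nat set \<Rightarrow> nat \<Rightarrow> nat" where
  "component \<gamma> l = sorted_list_of_set \<gamma> ! (l - 1)"

section \<open>Slots\<close>

definition slot :: "(nat \<Rightarrow> nat) \<Rightarrow> nat \<Rightarrow> enat" where
  "slot \<eta> x = (THE n.
     (\<exists>k \<gamma> l. soliton \<eta> k \<gamma> \<and> 1 \<le> l \<and> l \<le> k \<and>
        (x = component \<gamma> l \<or> x = component \<gamma> (l + k)) \<and> n = enat (l - 1)) \<or>
     (record_site \<eta> x \<and> n = \<infinity>))"

definition xi_tilde :: "(nat \<Rightarrow> nat) \<Rightarrow> nat \<Rightarrow> nat \<Rightarrow> nat" where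
  "xi_tilde \<eta> k x = (\<Sum>y = 1..x. of_bool (slot \<eta> y \<ge> enat k))"

definition s_tilde :: "(nat \<Rightarrow> nat) \<Rightarrow> nat \<Rightarrow> nat \<Rightarrow> nat" where
  "s_tilde \<eta> k i = (LEAST x. xi_tilde \<eta> k x = i)"

definition zeta_tilde :: "(nat \<Rightarrow> nat) \<Rightarrow> nat \<Rightarrow> nat \<Rightarrow> nat" where
  "zeta_tilde \<eta> k i =
     card {\<gamma>. soliton \<eta> k \<gamma> \<and> \<gamma> \<subseteq> {s_tilde \<eta> k i ..< s_tilde \<eta> k (i + 1)}}"

end

theory Submission
  imports Defs
begin

text \<open>Let a carrier with seats \<open>0, 1, 2, \<dots>\<close> read the configuration: a letter \<open>1\<close> occupies the lowest
  empty seat and a letter \<open>0\<close> vacates the lowest occupied one. Both the slots and the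
  rigged configuration can be read off the seat touched at each site (its \<^emph>\<open>level\<close>).

  On the KKR side, \<open>p\<^sub>k(x)\<close> is \<open>\<xi>\<^sub>k(x)\<close> minus the number of occupied seats below \<open>k\<close>, so a row of
  length \<open>k\<close> with rigging \<open>i - k\<close> is singular iff the seats below \<open>k\<close> are all occupied and
  \<open>\<xi>\<^sub>k(x) = i\<close>. The maximal singular length is therefore the lowest empty seat, and a \<open>1\<close> at level \<open>k\<close>
  turns a row of length \<open>k\<close> with rigging \<open>\<xi>\<^sub>k - k\<close> into one of length \<open>k + 1\<close> with rigging
  \<open>\<xi>\<^bsub>k+1\<^esub> - (k + 1)\<close>.

  On the TS side, the runs preceding the selected one are strictly decreasing, so the two halves of a
  \<open>k\<close>-soliton toggle the seats \<open>0, \<dots>, k - 1\<close> in this order, once each way. Crossing it out leaves the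
  levels of all other letters unchanged; hence slots are levels, and a soliton of size larger than \<open>k\<close>
  accounts for one row extension from \<open>k\<close> to \<open>k + 1\<close>. The rows of length \<open>k\<close> that are
  never extended correspond to the \<open>k\<close>-solitons.\<close>

section \<open>The carrier with numbered seats\<close>

text \<open>A letter \<open>b\<close> flips the lowest seat whose state differs from \<open>b\<close>. This treats \<open>1\<close> and \<open>0\<close>
  symmetrically; there is no such seat exactly when \<open>b\<close> is a \<open>0\<close> at a record.\<close>

definition lowest :: "bool \<Rightarrow> (nat \<Rightarrow> bool) \<Rightarrow> enat" where
  "lowest b c = (if \<exists>s. c s \<noteq> b then enat (LEAST s. c s \<noteq> b) else \<infinity>)"

definition fill :: "bool \<Rightarrow> (nat \<Rightarrow> bool) \<Rightarrow> nat \<Rightarrow> bool" where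
  "fill b c = (\<lambda>s. if lowest b c = enat s then b else c s)"

primrec seats :: "(nat \<Rightarrow> nat) \<Rightarrow> nat \<Rightarrow> nat \<Rightarrow> bool" where
  "seats \<eta> 0 = (\<lambda>_. False)"
| "seats \<eta> (Suc x) = fill (\<eta> (Suc x) = 1) (seats \<eta> x)"

text \<open>Indexed by integers to match the two-sided word. For \<open>y \<le> 0\<close> truncation
  by \<open>nat\<close> leaves the empty carrier reading a 0, so the level is \<infinity>.\<close>

definition level :: "(nat \<Rightarrow> nat) \<Rightarrow> int \<Rightarrow> enat" where
  "level \<eta> y = lowest (two_sided \<eta> y = 1) (seats \<eta> (nat (y - 1)))"

text \<open>The counting function of the slot decomposition with levels in place of slots;
  \<open>xi_tilde_eq\<close> shows that the two agree.\<close>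

definition xi :: "(nat \<Rightarrow> nat) \<Rightarrow> nat \<Rightarrow> nat \<Rightarrow> nat" where
  "xi \<eta> k x = (\<Sum>y = 1..x. of_bool (level \<eta> (int y) \<ge> enat k))"

text \<open>A 1 at level \<open>l\<close> extends a row of length \<open>l\<close> to
  \<open>l + 1\<close> (a new row if \<open>l = 0\<close>). Two indices are needed because rows of
  length \<open>k\<close> are created at level \<open>k - 1\<close> and lost at level
  \<open>k\<close>, while both events are timed by the same function
  \<open>xi \<eta> k\<close>.\<close>

definition ups :: "(nat \<Rightarrow> nat) \<Rightarrow> nat \<Rightarrow> nat \<Rightarrow> nat \<Rightarrow> nat \<Rightarrow> nat set" where
  "ups \<eta> x l k i = {y \<in> {1..x}. \<eta> y = 1 \<and> level \<eta> (int y) = enat l \<and> xi \<eta> k y = i}"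

lemma lowest_eq_enat_iff: "lowest b c = enat s \<longleftrightarrow> c s \<noteq> b \<and> (\<forall>t<s. c t = b)"
proof
  assume "lowest b c = enat s"
  then have ex: "\<exists>s. c s \<noteq> b" and s: "s = (LEAST s. c s \<noteq> b)"
    by (auto simp: lowest_def split: if_splits)
  show "c s \<noteq> b \<and> (\<forall>t<s. c t = b)"
    using LeastI_ex[OF ex] not_less_Least[of _ "\<lambda>s. c s \<noteq> b"] unfolding s by blast
next
  assume *: "c s \<noteq> b \<and> (\<forall>t<s. c t = b)"
  then have "(LEAST s. c s \<noteq> b) = s"
    by (intro Least_equality) (use leI in blast)+
  with * show "lowest b c = enat s" by (auto simp: lowest_def)
qed

lemma lowest_eq_infinity_iff: "lowest b c = \<infinity> \<longleftrightarrow> (\<forall>s. c s = b)"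
  by (auto simp: lowest_def)

lemma fill_eq: "lowest b c = enat s \<Longrightarrow> fill b c = c(s := b)"
  by (auto simp: fill_def)

lemma fill_infinity: "lowest b c = \<infinity> \<Longrightarrow> fill b c = c"
  by (auto simp: fill_def)

lemma finite_seats: "finite {s. seats \<eta> x s}"
proof (induction x)
  case (Suc x)
  have "{s. seats \<eta> (Suc x) s} \<subseteq> {s. seats \<eta> x s} \<union> {s. lowest (\<eta> (Suc x) = 1) (seats \<eta> x) = enat s}"
    by (auto simp: fill_def)
  moreover have "finite {s. lowest (\<eta> (Suc x) = 1) (seats \<eta> x) = enat s}"
    by (cases "lowest (\<eta> (Suc x) = 1) (seats \<eta> x)") auto
  ultimately show ?case using Suc finite_subset by blast
qed simp

lemma level_Suc: "level \<eta> (int (Suc x)) = lowest (\<eta> (Suc x) = 1) (seats \<eta> x)"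
  by (simp add: level_def two_sided_def nat_add_distrib)

lemma seats_int: "seats \<eta> (nat y) = fill (two_sided \<eta> y = 1) (seats \<eta> (nat (y - 1)))"
proof (cases "y \<ge> 1")
  case True
  then have "nat y = Suc (nat (y - 1))" by simp
  with True show ?thesis by (simp add: two_sided_def)
next
  case False
  then show ?thesis by (simp add: two_sided_def fill_def)
qed

text \<open>A 1 has infinite level only if all seats are occupied, which \<open>finite_seats\<close>
  excludes.\<close>

lemma level_one_finite:
  assumes "\<eta> (Suc x) = 1"
  obtains s where "level \<eta> (int (Suc x)) = enat s"
proof (cases "level \<eta> (int (Suc x))")
  case infinity
  then have "\<forall>s. seats \<eta> x s" using assms by (simp add: level_Suc lowest_eq_infinity_iff del: of_nat_Suc)
  then show ?thesis using finite_seats[of \<eta> x] infinite_UNIV_nat by simp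
qed

lemma xi_0 [simp]: "xi \<eta> k 0 = 0"
  by (simp add: xi_def)

lemma xi_Suc: "xi \<eta> k (Suc x) = xi \<eta> k x + of_bool (enat k \<le> level \<eta> (int (Suc x)))"
  by (simp add: xi_def)

lemma xi_mono: "x \<le> y \<Longrightarrow> xi \<eta> k x \<le> xi \<eta> k y"
  by (induction y rule: dec_induct) (auto simp: xi_Suc)

lemma finite_ups [simp]: "finite (ups \<eta> x l k i)"
  by (simp add: ups_def)

lemma ups_0 [simp]: "ups \<eta> 0 l k i = {}"
  by (simp add: ups_def)

lemma card_ups_Suc:
  "card (ups \<eta> (Suc x) l k i) = card (ups \<eta> x l k i) +
     of_bool (\<eta> (Suc x) = 1 \<and> level \<eta> (int (Suc x)) = enat l \<and> xi \<eta> k (Suc x) = i)"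
proof -
  have "ups \<eta> (Suc x) l k i = (if \<eta> (Suc x) = 1 \<and> level \<eta> (int (Suc x)) = enat l \<and> xi \<eta> k (Suc x) = i
     then insert (Suc x) (ups \<eta> x l k i) else ups \<eta> x l k i)"
    by (auto simp: ups_def le_Suc_eq simp del: of_nat_Suc)
  moreover have "Suc x \<notin> ups \<eta> x l k i" by (simp add: ups_def)
  ultimately show ?thesis by auto
qed

section \<open>The KKR construction in terms of levels\<close>

text \<open>The third clause keeps rows longer than the lowest empty seat from being singular. The
  fourth supplies a singular row at that seat; it is demanded at every boundary between an occupied
  and an empty seat, not only the lowest, so that it survives changes of lower seats. The last
  clause balances rows created and lost: a row of length \<open>k + 1\<close> is created when
  \<open>xi\<close> equals \<open>i\<close> and lost when \<open>xi\<close> moves from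
  \<open>i\<close> to \<open>i + 1\<close>, because the letter extending it has level
  \<open>k + 1\<close> and is itself counted; hence \<open>Suc i\<close>.\<close>

definition kkr_inv :: "(nat \<Rightarrow> nat) \<Rightarrow> nat \<Rightarrow> rigged_configuration \<Rightarrow> bool" where
  "kkr_inv \<eta> x = (\<lambda>(\<mu>, J).
     (\<forall>k. vacancy x \<mu> k = int (xi \<eta> k x) - int (card {s. s < k \<and> seats \<eta> x s})) \<and>
     (\<forall>k. sorted (J k) \<and> length (J k) = count \<mu> k) \<and>
     (\<forall>k. \<forall>v\<in>set (J k). v \<le> int (xi \<eta> k x) - int k) \<and>
     (\<forall>c. seats \<eta> x c \<and> \<not> seats \<eta> x (Suc c) \<longrightarrow> int (xi \<eta> (Suc c) x) - int (Suc c) \<in> set (J (Suc c))) \<and>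
     (\<forall>k i. count (mset (J (Suc k))) (int i - int (Suc k)) + card (ups \<eta> x (Suc k) (Suc k) (Suc i))
        = card (ups \<eta> x k (Suc k) i)))"

section \<open>Occupied seats, energies and top riggings\<close>

lemma card_seats_le: "card {s. s < k \<and> c s} \<le> k"
proof -
  have "card {s. s < k \<and> c s} \<le> card {..<k}" by (intro card_mono) auto
  then show ?thesis by simp
qed

lemma card_seats_full: "card {s. s < k \<and> c s} = k \<Longrightarrow> t < k \<Longrightarrow> c t"
proof -
  assume "card {s. s < k \<and> c s} = k" "t < k"
  then have "{s. s < k \<and> c s} = {..<k}" by (intro card_subset_eq) auto
  with \<open>t < k\<close> show "c t" by auto
qed

lemma card_seats_upd:
  fixes c :: "nat \<Rightarrow> bool"
  shows
  "card {s. s < k \<and> (c(t := True)) s} = card {s. s < k \<and> c s} + of_bool (t < k \<and> \<not> c t)"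
  "card {s. s < k \<and> (c(t := False)) s} + of_bool (t < k \<and> c t) = card {s. s < k \<and> c s}"
proof -
  have f: "finite {s. s < k \<and> d s}" for d :: "nat \<Rightarrow> bool"
    by (rule finite_subset[of _ "{..<k}"]) auto
  have "{s. s < k \<and> (c(t := True)) s} = (if t < k then insert t {s. s < k \<and> c s} else {s. s < k \<and> c s})"
    by auto
  then show "card {s. s < k \<and> (c(t := True)) s} = card {s. s < k \<and> c s} + of_bool (t < k \<and> \<not> c t)"
    using f by (auto simp: card_insert_if)
  have "{s. s < k \<and> c s} = (if t < k \<and> c t then insert t {s. s < k \<and> (c(t := False)) s} else {s. s < k \<and> (c(t := False)) s})"
    by auto
  then show "card {s. s < k \<and> (c(t := False)) s} + of_bool (t < k \<and> c t) = card {s. s < k \<and> c s}"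
    using f by (auto simp: card_insert_if)
qed

lemma energy_add: "energy (add_mset r \<mu>) k = min r k + energy \<mu> k"
  by (simp add: energy_def)

text \<open>Identifies the entry that the KKR step removes with \<open>butlast\<close>: an upper
  bound that is attained must be the last entry.\<close>

lemma sorted_count_butlast:
  fixes xs :: "int list"
  assumes "sorted xs" "v \<in> set xs" "\<forall>u\<in>set xs. u \<le> v"
  shows "last xs = v" "mset xs = add_mset v (mset (butlast xs))"
proof -
  from assms(2) have ne: "xs \<noteq> []" by auto
  then have xs: "xs = butlast xs @ [last xs]" by simp
  from assms(1) have "sorted (butlast xs @ [last xs])" using ne by simp
  then have "\<forall>u\<in>set xs. u \<le> last xs" using xs by (metis sorted_append Un_iff empty_iff insert_iff list.set(1) list.set(2) order_refl set_append)
  with assms ne show l: "last xs = v" by (simp add: order.antisym)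
  have "mset xs = mset (butlast xs @ [last xs])" using xs by simp
  then show "mset xs = add_mset v (mset (butlast xs))" using l by simp
qed

section \<open>The KKR step at a letter 1 of level \<open>s\<close>\<close>

context
  fixes \<eta> :: "nat \<Rightarrow> nat" and x s :: nat and \<mu> :: "nat multiset" and J :: rigging
  assumes inv: "kkr_inv \<eta> x (\<mu>, J)"
    and one: "\<eta> (Suc x) = 1" and lev: "level \<eta> (int (Suc x)) = enat s"
begin

lemma
  shows vacancy_eq: "vacancy x \<mu> k = int (xi \<eta> k x) - int (card {s. s < k \<and> seats \<eta> x s})"
    and sorted_rigging: "sorted (J k)" and length_rigging: "length (J k) = count \<mu> k"
    and rigging_bound: "v \<in> set (J k) \<Longrightarrow> v \<le> int (xi \<eta> k x) - int k"
    and top_rigging: "seats \<eta> x c \<Longrightarrow> \<not> seats \<eta> x (Suc c) \<Longrightarrow> int (xi \<eta> (Suc c) x) - int (Suc c) \<in> set (J (Suc c))"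
    and count_rigging: "count (mset (J (Suc k))) (int i - int (Suc k)) + card (ups \<eta> x (Suc k) (Suc k) (Suc i))
        = card (ups \<eta> x k (Suc k) i)"
  using inv by (auto simp: kkr_inv_def)

lemma seats_below_level: "\<not> seats \<eta> x s" "t < s \<Longrightarrow> seats \<eta> x t"
  using lev one by (auto simp: level_Suc lowest_eq_enat_iff simp del: of_nat_Suc)

lemma top_rigging_level: "s \<noteq> 0 \<Longrightarrow> int (xi \<eta> s x) - int s \<in> set (J s)"
  using top_rigging[of "s - 1"] seats_below_level by auto

lemma rig_last: "k \<in># \<mu> \<Longrightarrow> rig J k (count \<mu> k) = last (J k)"
  unfolding rig_def length_rigging[symmetric] by (metis count_eq_zero_iff last_conv_nth length_rigging length_0_conv)

text \<open>Together with the rigging bound, singularity forces all seats below \<open>k\<close> to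
  be occupied, but seat \<open>s\<close> is empty.\<close>

lemma singular_le: "k \<in> singular_lengths x (\<mu>, J) \<Longrightarrow> k \<le> s"
proof (rule ccontr)
  assume k: "k \<in> singular_lengths x (\<mu>, J)" and "\<not> k \<le> s"
  then have km: "k \<in># \<mu>" and "vacancy x \<mu> k = last (J k)"
    by (auto simp: singular_lengths_def rig_last)
  moreover have "J k \<noteq> []" using km length_rigging[of k] by (auto simp flip: count_greater_zero_iff)
  ultimately have "vacancy x \<mu> k \<le> int (xi \<eta> k x) - int k" using rigging_bound by simp
  then have "card {s. s < k \<and> seats \<eta> x s} = k"
    using vacancy_eq card_seats_le[of k "seats \<eta> x"] by simp
  from card_seats_full[OF this, of s] \<open>\<not> k \<le> s\<close> seats_below_level show False by simp
qed

text \<open>Seat \<open>s\<close> is the lowest empty one, so exactly \<open>s\<close> seats are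
  occupied below it and the vacancy number equals the top rigging guaranteed by the
  invariant.\<close>

lemma singular_s: "s \<noteq> 0 \<Longrightarrow> s \<in> singular_lengths x (\<mu>, J)"
proof -
  assume "s \<noteq> 0"
  note t = top_rigging_level[OF this]
  then have "length (J s) \<noteq> 0" by auto
  then have m: "s \<in># \<mu>" using length_rigging[of s] by simp
  have "{t. t < s \<and> seats \<eta> x t} = {..<s}" using seats_below_level by auto
  then have "vacancy x \<mu> s = int (xi \<eta> s x) - int s" using vacancy_eq by simp
  moreover have "last (J s) = int (xi \<eta> s x) - int s"
    using sorted_count_butlast[OF sorted_rigging t] rigging_bound by blast
  ultimately show ?thesis using m by (simp add: singular_lengths_def rig_last)
qed

lemma zero_notin: "0 \<notin># \<mu> \<Longrightarrow> s = 0 \<Longrightarrow> singular_lengths x (\<mu>, J) = {}"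
  using singular_le by (fastforce simp: singular_lengths_def)

lemma finite_singular: "finite (singular_lengths x (\<mu>, J))"
  using singular_le by (meson finite_atMost finite_subset atMost_iff subsetI)

lemma Max_singular: "s \<noteq> 0 \<Longrightarrow> Max (singular_lengths x (\<mu>, J)) = s"
  using singular_le singular_s finite_singular by (intro Max_eqI)

text \<open>Merges both branches of the step by treating a new row as the extension of a row of
  length 0: for \<open>s = 0\<close> the removal from \<open>\<mu>\<close> and the
  \<open>butlast\<close> of \<open>J 0\<close> have no effect.\<close>

lemma kkr_step_eq:
  assumes "0 \<notin># \<mu>"
  defines "\<mu>' \<equiv> add_mset (Suc s) (\<mu> - {#s#})"
  shows "kkr_step x (\<mu>, J) = (\<mu>', J(s := butlast (J s), Suc s := insort (vacancy (Suc x) \<mu>' (Suc s)) (J (Suc s))))"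
proof (cases "s = 0")
  case True
  have "\<mu> - {#0#} = \<mu>" using assms(1) by simp
  moreover have "butlast (J 0) = J 0" using length_rigging[of 0] assms(1) by (simp add: not_in_iff)
  ultimately show ?thesis using True zero_notin[OF assms(1) True]
    by (simp add: kkr_step_def \<mu>'_def Let_def)
next
  case False
  then show ?thesis using singular_s[OF False] Max_singular[OF False]
    by (auto simp: kkr_step_def \<mu>'_def Let_def)
qed

lemma xi_eq: "xi \<eta> k (Suc x) = xi \<eta> k x + of_bool (k \<le> s)"
  by (simp add: xi_Suc lev del: of_nat_Suc)

lemma kkr_inv_step:
  assumes "0 \<notin># \<mu>"
  shows "kkr_inv \<eta> (Suc x) (kkr_step x (\<mu>, J))"
proof -
  define \<mu>' where "\<mu>' = add_mset (Suc s) (\<mu> - {#s#})"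
  define c' where "c' = seats \<eta> (Suc x)"
  have c': "c' = (seats \<eta> x)(s := True)"
    using lev one by (simp add: c'_def level_Suc fill_eq del: of_nat_Suc)
  have sm: "s \<noteq> 0 \<Longrightarrow> s \<in># \<mu>" using singular_s by (auto simp: singular_lengths_def)
  \<comment> \<open>The added cell lies in column \<open>s + 1\<close>, so it counts towards the
    energy exactly for \<open>k > s\<close>.\<close>
  have en: "energy \<mu>' k = energy \<mu> k + of_bool (s < k)" for k
  proof (cases "s = 0")
    case True
    then have "\<mu>' = add_mset 1 \<mu>" using assms by (simp add: \<mu>'_def)
    then show ?thesis using True by (auto simp: energy_add)
  next
    case False
    then have "\<mu> = add_mset s (\<mu> - {#s#})" using sm by simp
    then have "energy \<mu> k = min s k + energy (\<mu> - {#s#}) k" by (metis energy_add)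
    then show ?thesis by (auto simp: \<mu>'_def energy_add)
  qed
  \<comment> \<open>Reading the 1 raises \<open>xi \<eta> k\<close> if \<open>k \<le> s\<close> and
    the number of occupied seats below \<open>k\<close> if \<open>k > s\<close>, so their difference
    changes by \<open>1 - 2 * of_bool (s < k)\<close>, as the vacancy number does.\<close>
  have vac': "vacancy (Suc x) \<mu>' k = int (xi \<eta> k (Suc x)) - int (card {s. s < k \<and> c' s})" for k
  proof -
    have "vacancy (Suc x) \<mu>' k = vacancy x \<mu> k + 1 - 2 * of_bool (s < k)"
      by (simp add: vacancy_def en)
    then show ?thesis using seats_below_level by (auto simp: vacancy_eq c' card_seats_upd xi_eq simp del: fun_upd_apply)
  qed
  have full: "{t. t < Suc s \<and> c' t} = {..<Suc s}" using seats_below_level by (auto simp: c' less_Suc_eq)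
  \<comment> \<open>The level \<open>s\<close> is below \<open>Suc s\<close>, so this
    \<open>xi\<close> has the same value at \<open>x\<close> and at \<open>Suc x\<close>.\<close>
  define v where "v = int (xi \<eta> (Suc s) x) - int (Suc s)"
  have v: "vacancy (Suc x) \<mu>' (Suc s) = v"
    unfolding vac' full by (simp add: v_def xi_eq)
  define J' where "J' = J(s := butlast (J s), Suc s := insort v (J (Suc s)))"
  have step: "kkr_step x (\<mu>, J) = (\<mu>', J')"
    using kkr_step_eq[OF assms] v by (simp add: \<mu>'_def J'_def)
  have J0: "J 0 = []" using length_rigging[of 0] assms by (simp add: not_in_iff)
  have ms: "s \<noteq> 0 \<Longrightarrow> mset (J s) = add_mset (int (xi \<eta> s x) - int s) (mset (butlast (J s)))"
    using sorted_count_butlast(2)[OF sorted_rigging top_rigging_level] rigging_bound by blast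
  have srt': "sorted (J' k)" for k
    using sorted_rigging by (auto simp: J'_def sorted_insort butlast_conv_take sorted_wrt_take)
  have len': "length (J' k) = count \<mu>' k" for k
    using length_rigging assms by (auto simp: J'_def \<mu>'_def not_in_iff)
  have bound': "u \<le> int (xi \<eta> k (Suc x)) - int k" if "u \<in> set (J' k)" for k u
  proof -
    have "u \<in> set (J k) \<or> (k = Suc s \<and> u = v)"
      using that by (auto simp: J'_def set_insort_key split: if_splits dest: in_set_butlastD)
    then show ?thesis
    proof
      assume "u \<in> set (J k)"
      from rigging_bound[OF this] show ?thesis by (simp add: xi_eq)
    next
      assume "k = Suc s \<and> u = v" then show ?thesis by (simp add: v_def xi_eq)
    qed
  qed
  \<comment> \<open>A boundary at \<open>s\<close> gets its row from this step. Every other boundary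
    lies above \<open>s\<close>, where neither the rigging nor \<open>xi\<close> changes.\<close>
  have top': "int (xi \<eta> (Suc c) (Suc x)) - int (Suc c) \<in> set (J' (Suc c))"
    if "c' c" "\<not> c' (Suc c)" for c
  proof (cases "c = s")
    case True
    then show ?thesis by (simp add: J'_def v_def xi_eq set_insort_key)
  next
    case False
    then have "seats \<eta> x c" "\<not> seats \<eta> x (Suc c)" "Suc c \<noteq> s"
      using that by (auto simp: c' split: if_splits)
    moreover from this have "s < c" using seats_below_level False by (metis not_less_iff_gr_or_eq Suc_lessI)
    ultimately show ?thesis using top_rigging by (simp add: J'_def xi_eq)
  qed
  \<comment> \<open>Only length \<open>s\<close> can lose a row and only length \<open>s + 1\<close>
    gains one; the corresponding \<open>ups\<close> sets gain the current site.\<close>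
  have cnt': "count (mset (J' (Suc k))) (int i - int (Suc k)) + card (ups \<eta> (Suc x) (Suc k) (Suc k) (Suc i))
        = card (ups \<eta> (Suc x) k (Suc k) i)" for k i
  proof -
    consider "Suc k = s" | "k = s" | "Suc k \<noteq> s" "k \<noteq> s" by blast
    then show ?thesis
    proof cases
      case 1
      then have "count (mset (J (Suc k))) (int i - int (Suc k)) = count (mset (J' (Suc k))) (int i - int (Suc k)) + of_bool (xi \<eta> s x = i)"
        using ms by (auto simp: J'_def)
      then show ?thesis using count_rigging[of k i] one lev 1
        by (auto simp: card_ups_Suc xi_eq simp del: of_nat_Suc)
    next
      case 2
      then have "count (mset (J' (Suc k))) (int i - int (Suc k)) = count (mset (J (Suc k))) (int i - int (Suc k)) + of_bool (xi \<eta> (Suc s) x = i)"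
        by (auto simp: J'_def v_def)
      then show ?thesis using count_rigging[of k i] one lev 2
        by (auto simp: card_ups_Suc xi_eq simp del: of_nat_Suc)
    next
      case 3
      then show ?thesis using count_rigging[of k i] lev
        by (auto simp: card_ups_Suc J'_def simp del: of_nat_Suc)
    qed
  qed
  show ?thesis unfolding step kkr_inv_def
    using vac' srt' len' bound' top' cnt' by (simp add: c'_def del: seats.simps)
qed

lemma kkr_step_zero_notin: "0 \<notin># \<mu> \<Longrightarrow> 0 \<notin># fst (kkr_step x (\<mu>, J))"
  by (auto simp: kkr_step_eq dest: in_diffD)

end

lemma kkr_inv_skip:
  assumes inv: "kkr_inv \<eta> x (\<mu>, J)" and zero: "\<eta> (Suc x) \<noteq> 1"
  shows "kkr_inv \<eta> (Suc x) (\<mu>, J)"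
proof -
  have low: "level \<eta> (int (Suc x)) = lowest False (seats \<eta> x)"
    using zero by (simp add: level_Suc del: of_nat_Suc)
  have st: "seats \<eta> (Suc x) = fill False (seats \<eta> x)" using zero by simp
  have xi': "xi \<eta> k x \<le> xi \<eta> k (Suc x)" for k by (simp add: xi_mono)
  have ups': "card (ups \<eta> (Suc x) l k i) = card (ups \<eta> x l k i)" for l k i
    using zero by (simp add: card_ups_Suc)
  \<comment> \<open>Either the level is at least \<open>k\<close> and \<open>xi\<close> grows, or a
    seat below \<open>k\<close> is vacated; never both.\<close>
  have vac: "int (xi \<eta> k (Suc x)) - int (card {s. s < k \<and> seats \<eta> (Suc x) s}) =
     int (xi \<eta> k x) - int (card {s. s < k \<and> seats \<eta> x s}) + 1" for k
  proof (cases "lowest False (seats \<eta> x)")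
    case (enat t)
    have "seats \<eta> (Suc x) = (seats \<eta> x)(t := False)" using st fill_eq[OF enat] by simp
    moreover have "seats \<eta> x t" using enat by (simp add: lowest_eq_enat_iff)
    ultimately show ?thesis using card_seats_upd(2)[of k "seats \<eta> x" t]
      by (auto simp: xi_Suc low enat simp del: of_nat_Suc fun_upd_apply seats.simps split: if_splits)
  next
    case infinity
    then show ?thesis using st fill_infinity[OF infinity]
      by (simp add: xi_Suc low del: of_nat_Suc seats.simps)
  qed
  \<comment> \<open>A boundary present afterwards lies above the vacated seat \<open>t\<close>, so
    it was present before and its \<open>xi\<close> did not move.\<close>
  have top: "seats \<eta> x c \<and> \<not> seats \<eta> x (Suc c) \<and> xi \<eta> (Suc c) (Suc x) = xi \<eta> (Suc c) x"
    if "seats \<eta> (Suc x) c" "\<not> seats \<eta> (Suc x) (Suc c)" for c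
  proof (cases "lowest False (seats \<eta> x)")
    case (enat t)
    have s: "seats \<eta> (Suc x) = (seats \<eta> x)(t := False)" using st fill_eq[OF enat] by simp
    have t: "\<forall>u<t. \<not> seats \<eta> x u" using enat by (simp add: lowest_eq_enat_iff)
    from that have "seats \<eta> x c" "c \<noteq> t" unfolding s by (auto split: if_splits)
    with t have "t < c" by (meson linorder_neqE_nat)
    with that show ?thesis unfolding s by (simp add: xi_Suc low enat del: of_nat_Suc)
  next
    case infinity
    then show ?thesis using that st fill_infinity[OF infinity]
      by (simp add: lowest_eq_infinity_iff del: seats.simps)
  qed
  have "vacancy (Suc x) \<mu> k = vacancy x \<mu> k + 1" for k by (simp add: vacancy_def)
  then show ?thesis using inv vac top ups' xi' unfolding kkr_inv_def
    by (fastforce simp del: seats.simps of_nat_Suc intro: order_trans)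
qed

lemma kkr_inv_kkr: "kkr_inv \<eta> x (kkr \<eta> x) \<and> 0 \<notin># fst (kkr \<eta> x)"
proof (induction x)
  case 0
  then show ?case by (simp add: kkr_inv_def vacancy_def energy_def)
next
  case (Suc x)
  obtain \<mu> J where k: "kkr \<eta> x = (\<mu>, J)" by fastforce
  show ?case
  proof (cases "\<eta> (Suc x) = 1")
    case True
    then obtain s where "level \<eta> (int (Suc x)) = enat s" by (rule level_one_finite)
    moreover have "kkr_inv \<eta> x (\<mu>, J)" "0 \<notin># \<mu>" using Suc k by auto
    ultimately show ?thesis using True k kkr_inv_step kkr_step_zero_notin by auto
  next
    case False
    then show ?thesis using Suc k kkr_inv_skip by simp
  qed
qed

section \<open>Runs\<close>

definition convex_in :: "int set \<Rightarrow> int set \<Rightarrow> bool" where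
  "convex_in U S \<longleftrightarrow> S \<subseteq> U \<and> (\<forall>a\<in>S. \<forall>b\<in>S. {a..b} \<inter> U \<subseteq> S)"

definition adjacent :: "int set \<Rightarrow> int \<Rightarrow> int \<Rightarrow> bool" where
  "adjacent U x y \<longleftrightarrow> x \<in> U \<and> y \<in> U \<and> x < y \<and> {x<..<y} \<inter> U = {}"

definition rank :: "int set \<Rightarrow> int \<Rightarrow> nat" where
  "rank S x = card {y \<in> S. y < x}"

definition run_of :: "(int \<Rightarrow> nat) \<Rightarrow> int set \<Rightarrow> int \<Rightarrow> int set" where
  "run_of w U x = {y \<in> U. \<forall>z\<in>U. min x y \<le> z \<and> z \<le> max x y \<longrightarrow> w z = w x}"

lemma convex_inD:
  assumes "convex_in U S" "a \<in> S" "b \<in> S" "a \<le> z" "z \<le> b" "z \<in> U" shows "z \<in> S"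
proof -
  have "{a..b} \<inter> U \<subseteq> S" using assms(1-3) by (simp add: convex_in_def)
  then show ?thesis using assms(4-6) by auto
qed

lemma equal_string_convex: "equal_string w U S \<Longrightarrow> convex_in U S"
  by (simp add: equal_string_def convex_in_def)

lemma equal_string_letter: "equal_string w U S \<Longrightarrow> a \<in> S \<Longrightarrow> b \<in> S \<Longrightarrow> w a = w b"
  by (auto simp: equal_string_def)

lemma equal_stringI:
  "x \<in> S \<Longrightarrow> convex_in U S \<Longrightarrow> (\<And>y. y \<in> S \<Longrightarrow> w y = w x) \<Longrightarrow> equal_string w U S"
  unfolding equal_string_def convex_in_def by blast

lemma run_of_self: "x \<in> U \<Longrightarrow> x \<in> run_of w U x"
  by (auto simp: run_of_def)

lemma equal_string_run_of:
  assumes "x \<in> U" shows "equal_string w U (run_of w U x)"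
proof (rule equal_stringI[OF run_of_self[OF assms]])
  show "convex_in U (run_of w U x)"
    unfolding convex_in_def
  proof (intro conjI ballI subsetI)
    fix a b z assume a: "a \<in> run_of w U x" and b: "b \<in> run_of w U x" and z: "z \<in> {a..b} \<inter> U"
    have "w t = w x" if "t \<in> U" "min x z \<le> t" "t \<le> max x z" for t
    proof (cases "z \<le> x")
      case True
      then have "min x a \<le> t" "t \<le> max x a" using that z by auto
      then show ?thesis using a that by (auto simp: run_of_def)
    next
      case False
      then have "min x b \<le> t" "t \<le> max x b" using that z by auto
      then show ?thesis using b that by (auto simp: run_of_def)
    qed
    then show "z \<in> run_of w U x" using z by (auto simp: run_of_def)
  qed (auto simp: run_of_def)
qed (auto simp: run_of_def)

lemma equal_string_subset_run_of:
  assumes "equal_string w U S" "x \<in> S" shows "S \<subseteq> run_of w U x"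
proof
  fix y assume y: "y \<in> S"
  have S: "S \<subseteq> U" using assms by (simp add: equal_string_def)
  have "w z = w x" if z: "z \<in> U" "min x y \<le> z" "z \<le> max x y" for z
  proof -
    have "z \<in> S"
    proof (cases "x \<le> y")
      case True
      then show ?thesis using convex_inD[OF equal_string_convex[OF assms(1)] assms(2) y] z by simp
    next
      case False
      then show ?thesis using convex_inD[OF equal_string_convex[OF assms(1)] y assms(2)] z by simp
    qed
    then show ?thesis using equal_string_letter assms by metis
  qed
  then show "y \<in> run_of w U x" using y S by (auto simp: run_of_def)
qed

text \<open>Maximality holds since any equal string through \<open>x\<close> lies inside
  \<open>run_of w U x\<close>. Runs are thereby reduced to this explicit set.\<close>

lemma run_run_of:
  assumes "x \<in> U" shows "run w U (run_of w U x)"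
  using equal_string_run_of[OF assms] equal_string_subset_run_of run_of_self[OF assms]
  unfolding run_def by (meson subsetD subset_antisym)

lemma run_eq_run_of: "run w U Q \<Longrightarrow> x \<in> Q \<Longrightarrow> Q = run_of w U x"
proof -
  assume Q: "run w U Q" "x \<in> Q"
  then have "x \<in> U" by (auto simp: run_def equal_string_def)
  then show ?thesis using Q equal_string_run_of equal_string_subset_run_of unfolding run_def by metis
qed

lemma run_eqI: "run w U Q \<Longrightarrow> run w U Q' \<Longrightarrow> x \<in> Q \<Longrightarrow> x \<in> Q' \<Longrightarrow> Q = Q'"
  using run_eq_run_of by metis

lemma run_equal_string: "run w U Q \<Longrightarrow> equal_string w U Q"
  by (simp add: run_def)

lemma run_convex: "run w U Q \<Longrightarrow> convex_in U Q"
  by (rule equal_string_convex[OF run_equal_string])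

lemma run_subset: "run w U Q \<Longrightarrow> Q \<subseteq> U"
  by (simp add: run_def equal_string_def)

lemma run_nonempty: "run w U Q \<Longrightarrow> Q \<noteq> {}"
  by (simp add: run_def equal_string_def)

lemma run_letter: "run w U Q \<Longrightarrow> a \<in> Q \<Longrightarrow> b \<in> Q \<Longrightarrow> w a = w b"
  using run_equal_string equal_string_letter by metis

text \<open>A violation would, by convexity, put a site of one run into the other, but distinct runs
  are disjoint. So one compared pair decides the order of two runs.\<close>

lemma run_order:
  assumes "run w U Q" "run w U Q'" "Q \<noteq> Q'" "x \<in> Q" "y \<in> Q'" "x < y" "a \<in> Q" "b \<in> Q'"
  shows "a < b"
proof (rule ccontr)
  assume "\<not> a < b"
  then have "b \<le> a" by simp
  have s: "a \<in> U" "b \<in> U" "x \<in> U" "y \<in> U" using assms run_subset by blast+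
  have disj: False if "z \<in> Q" "z \<in> Q'" for z using run_eqI[OF assms(1,2) that] assms(3) by simp
  show False
  proof (cases "y \<le> a")
    case True
    then have "y \<in> Q" using convex_inD[OF run_convex[OF assms(1)] assms(4,7)] s assms by simp
    then show False using disj assms by blast
  next
    case False
    then have "a \<in> Q'" using convex_inD[OF run_convex[OF assms(2)] assms(8,5)] s assms \<open>b \<le> a\<close> by simp
    then show False using disj assms by blast
  qed
qed

section \<open>Consecutive runs\<close>

lemma preceding_run_less: "preceding_run w U P R \<Longrightarrow> p \<in> P \<Longrightarrow> r \<in> R \<Longrightarrow> p < r"
  by (simp add: preceding_run_def)

lemma preceding_run_between:
  assumes "preceding_run w U P R" "p \<in> P" "r \<in> R" "p \<le> z" "z \<le> r" "z \<in> U"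
  shows "z \<in> P \<union> R"
proof -
  have "{p..r} \<inter> U \<subseteq> P \<union> R" using assms(1-3) by (simp add: preceding_run_def)
  then show ?thesis using assms(4-6) by auto
qed

lemma preceding_run_convex:
  assumes "preceding_run w U P R" shows "convex_in U (P \<union> R)"
  unfolding convex_in_def
proof (intro conjI ballI subsetI)
  have PR: "run w U P" "run w U R" using assms by (auto simp: preceding_run_def)
  then show "x \<in> U" if "x \<in> P \<union> R" for x using that run_subset by blast
  fix a b z assume ab: "a \<in> P \<union> R" "b \<in> P \<union> R" and z: "z \<in> {a..b} \<inter> U"
  then have z': "a \<le> z" "z \<le> b" "z \<in> U" by auto
  consider "a \<in> P" "b \<in> P" | "a \<in> R" "b \<in> R" | "a \<in> P" "b \<in> R" | "a \<in> R" "b \<in> P" using ab by auto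
  then show "z \<in> P \<union> R"
  proof cases
    case 1 then show ?thesis using convex_inD[OF run_convex[OF PR(1)] _ _ z'] by simp
  next
    case 2 then show ?thesis using convex_inD[OF run_convex[OF PR(2)] _ _ z'] by simp
  next
    case 3 then show ?thesis using preceding_run_between[OF assms _ _ z'] by simp
  next
    case 4 then show ?thesis using preceding_run_less[OF assms, of b a] z' by simp
  qed
qed

text \<open>With equal letters \<open>P \<union> R\<close> would be an equal string, against the
  maximality of \<open>P\<close>.\<close>

lemma preceding_run_letters:
  assumes "preceding_run w U P R" "p \<in> P" "r \<in> R" shows "w p \<noteq> w r"
proof
  assume eq: "w p = w r"
  have PR: "run w U P" "run w U R" using assms by (auto simp: preceding_run_def)
  have "equal_string w U (P \<union> R)"
  proof (rule equal_stringI)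
    show "p \<in> P \<union> R" using assms by simp
    show "convex_in U (P \<union> R)" by (rule preceding_run_convex[OF assms(1)])
    show "w y = w p" if "y \<in> P \<union> R" for y
      using that run_letter[OF PR(1) _ assms(2)] run_letter[OF PR(2) _ assms(3)] eq by auto
  qed
  then have "r \<in> P" using PR(1) assms unfolding run_def by blast
  then show False using preceding_run_less[OF assms(1)] assms by blast
qed

text \<open>A site of one candidate to the right of a site of the other falls between the other
  candidate and \<open>R\<close>, hence into that candidate.\<close>

lemma preceding_run_unique:
  assumes "preceding_run w U P R" "preceding_run w U P' R" shows "P = P'"
proof -
  have *: "P = P'" if "preceding_run w U P R" "preceding_run w U P' R" "p \<in> P" "p' \<in> P'" "p \<le> p'"
    for P P' p p'
  proof -
    have PR: "run w U P" "run w U P'" "run w U R" using that by (auto simp: preceding_run_def)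
    obtain r where r: "r \<in> R" using run_nonempty[OF PR(3)] by blast
    have "p' < r" "p' \<in> U" using preceding_run_less[OF that(2)] that r run_subset[OF PR(2)] by auto
    then have "p' \<in> P \<union> R" using preceding_run_between[OF that(1,3) r] that by simp
    moreover have "p' \<notin> R" using preceding_run_less[OF that(2,4)] by blast
    ultimately show ?thesis using run_eqI[OF PR(1,2)] that by blast
  qed
  obtain p p' where "p \<in> P" "p' \<in> P'"
    using assms run_nonempty unfolding preceding_run_def by (meson ex_in_conv)
  then show ?thesis using *[OF assms] *[OF assms(2,1)] by (metis linear)
qed

lemma adjacent_preceding:
  assumes adj: "adjacent U x y" and ne: "w x \<noteq> w y"
  shows "preceding_run w U (run_of w U x) (run_of w U y)"
proof -
  have xy: "x \<in> U" "y \<in> U" "x < y" using adj by (auto simp: adjacent_def)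
  note R = run_run_of[OF xy(1), of w] run_run_of[OF xy(2), of w]
  note S = run_of_self[OF xy(1), of w] run_of_self[OF xy(2), of w]
  have neq: "run_of w U x \<noteq> run_of w U y" using run_letter[OF R(1)] S ne by metis
  have "p < r \<and> {p..r} \<inter> U \<subseteq> run_of w U x \<union> run_of w U y"
    if p: "p \<in> run_of w U x" and r: "r \<in> run_of w U y" for p r
  proof (intro conjI subsetI)
    show "p < r" by (rule run_order[OF R neq S xy(3) p r])
    fix z assume z: "z \<in> {p..r} \<inter> U"
    then have "z \<notin> {x<..<y}" using adj unfolding adjacent_def by blast
    then have "z \<le> x \<or> y \<le> z" by auto
    then show "z \<in> run_of w U x \<union> run_of w U y"
      using z convex_inD[OF run_convex[OF R(1)] p S(1)] convex_inD[OF run_convex[OF R(2)] S(2) r] by auto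
  qed
  then show ?thesis using R by (simp add: preceding_run_def)
qed

section \<open>Determinism of the algorithm and disjointness of its solitons\<close>

lemma selected_run_unique:
  assumes "selected_run w U P R" "selected_run w U P' R'" shows "P = P' \<and> R = R'"
proof -
  have e: "eligible_run w U P R" "eligible_run w U P' R'" using assms by (auto simp: selected_run_def)
  have r: "run w U R" "run w U R'" using e by (auto simp: eligible_run_def preceding_run_def)
  obtain a b where "a \<in> R" "b \<in> R'" using r run_nonempty by (metis ex_in_conv)
  moreover have "R' = R \<or> (\<forall>r\<in>R. \<forall>r'\<in>R'. r < r')"
    using assms(1) e(2) by (simp add: selected_run_def)
  moreover have "R = R' \<or> (\<forall>r\<in>R'. \<forall>r'\<in>R. r < r')"
    using assms(2) e(1) by (simp add: selected_run_def)
  ultimately have "R = R'" by (meson less_asym)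
  then show ?thesis using e preceding_run_unique[of w U P R P'] by (simp add: eligible_run_def)
qed

lemma ts_round_unique: "ts_round w U k G \<Longrightarrow> ts_round w U k' G' \<Longrightarrow> k = k' \<and> G = G'" (is "_ \<Longrightarrow> _ \<Longrightarrow> ?thesis")
proof -
  assume "ts_round w U k G" "ts_round w U k' G'"
  then obtain P R P' R' where *: "selected_run w U P R" "run_length P = enat k"
      "G = last_letters k P \<union> first_letters k R" "selected_run w U P' R'" "run_length P' = enat k'"
      "G' = last_letters k' P' \<union> first_letters k' R'"
    unfolding ts_round_def by blast
  have "P = P' \<and> R = R'" by (rule selected_run_unique[OF *(1,4)])
  then show ?thesis using *(2,3,5,6) by simp
qed

text \<open>One round as a total function on states, the identity once no round is possible. The
  states of the algorithm become the iterates of \<open>UNIV\<close>, which makes any two of them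
  comparable in time.\<close>

definition crossing :: "(int \<Rightarrow> nat) \<Rightarrow> int set \<Rightarrow> int set" where
  "crossing w U = {x \<in> U. \<forall>k G. ts_round w U k G \<longrightarrow> x \<notin> G}"

lemma crossing_eq: "ts_round w U k G \<Longrightarrow> crossing w U = U - G"
  unfolding crossing_def using ts_round_unique by blast

lemma ts_uncrossed_iff: "ts_uncrossed w U \<longleftrightarrow> (\<exists>n. U = (crossing w ^^ n) UNIV)"
proof
  assume "ts_uncrossed w U" then show "\<exists>n. U = (crossing w ^^ n) UNIV"
  proof induction
    case start
    then show ?case by (intro exI[of _ 0]) simp
  next
    case (cross U k G)
    then obtain n where "U = (crossing w ^^ n) UNIV" by blast
    then show ?case using crossing_eq[OF cross(2)] by (intro exI[of _ "Suc n"]) simp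
  qed
next
  have "ts_uncrossed w ((crossing w ^^ n) UNIV)" for n
  proof (induction n)
    case (Suc n)
    then show ?case
    proof (cases "\<exists>k G. ts_round w ((crossing w ^^ n) UNIV) k G")
      case True
      then show ?thesis using Suc crossing_eq ts_uncrossed.cross by fastforce
    next
      case False
      then have "crossing w ((crossing w ^^ n) UNIV) = (crossing w ^^ n) UNIV" by (auto simp: crossing_def)
      then show ?thesis using Suc by simp
    qed
  qed (simp add: ts_uncrossed.start)
  then show "\<exists>n. U = (crossing w ^^ n) UNIV \<Longrightarrow> ts_uncrossed w U" by blast
qed

lemma crossing_antimono: "m \<le> n \<Longrightarrow> (crossing w ^^ n) U \<subseteq> (crossing w ^^ m) U"
  by (induction n rule: dec_induct) (auto simp: crossing_def)

lemma ts_round_subset: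
  assumes "ts_round w U k G" shows "G \<subseteq> U"
proof -
  obtain P R where "run w U P" "run w U R" "G = last_letters k P \<union> first_letters k R"
    using assms by (auto simp: ts_round_def selected_run_def eligible_run_def preceding_run_def)
  moreover have "last_letters k P \<subseteq> P" "first_letters k R \<subseteq> R"
    by (auto simp: last_letters_def first_letters_def)
  ultimately show ?thesis using run_subset[of w U P] run_subset[of w U R] by blast
qed

text \<open>The earlier soliton is already removed from the state in which the later one is
  selected; rounds in the same state coincide by determinism.\<close>

lemma ts_round_disjoint:
  assumes "ts_uncrossed w U" "ts_round w U k G" "ts_uncrossed w V" "ts_round w V l H" "x \<in> G" "x \<in> H"
  shows "k = l \<and> G = H"
proof -
  obtain m n where mn: "U = (crossing w ^^ m) UNIV" "V = (crossing w ^^ n) UNIV"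
    using assms ts_uncrossed_iff by metis
  have *: False if "Suc m \<le> n" "ts_round w ((crossing w ^^ m) UNIV) k G" "H \<subseteq> (crossing w ^^ n) UNIV"
    "x \<in> G" "x \<in> H" for m n k G H x
    using crossing_antimono[OF that(1), of w UNIV] that crossing_eq[OF that(2)] by auto
  consider "Suc m \<le> n" | "Suc n \<le> m" | "m = n" by linarith
  then show ?thesis
  proof cases
    case 3
    then show ?thesis using ts_round_unique assms mn by metis
  qed (use * assms mn ts_round_subset in metis)+
qed

section \<open>First and last letters of a run\<close>

lemma first_letters_eq: "bdd_below R \<Longrightarrow> first_letters k R = {r \<in> R. rank R r < k}"
proof -
  assume "bdd_below R"
  then obtain m where "\<And>r. r \<in> R \<Longrightarrow> m \<le> r" by (auto simp: bdd_below_def)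
  then have "{s \<in> R. s < r} \<subseteq> {m..r}" for r by auto
  then have "finite {s \<in> R. s < r}" for r by (meson finite_atLeastAtMost_int finite_subset)
  then show ?thesis by (simp add: first_letters_def rank_def)
qed

lemma last_letters_eq:
  assumes "finite P" "card P = k" shows "last_letters k P = P"
proof -
  have "card {q \<in> P. p < q} < card P" if "p \<in> P" for p
    using assms that by (intro psubset_card_mono) auto
  then show ?thesis using assms by (auto simp: last_letters_def)
qed

lemma first_element:
  fixes R :: "int set"
  assumes "bdd_below R" "R \<noteq> {}" obtains m where "m \<in> R" "\<And>r. r \<in> R \<Longrightarrow> m \<le> r"
proof -
  obtain r0 c where r0: "r0 \<in> R" and c: "\<And>r. r \<in> R \<Longrightarrow> c \<le> r"
    using assms by (auto simp: bdd_below_def)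
  have fin: "finite (R \<inter> {..r0})" by (rule finite_subset[of _ "{c..r0}"]) (use c in auto)
  have ne: "R \<inter> {..r0} \<noteq> {}" using r0 by auto
  have "Min (R \<inter> {..r0}) \<in> R" using Min_in[OF fin ne] by simp
  moreover have "Min (R \<inter> {..r0}) \<le> r" if "r \<in> R" for r
  proof (cases "r \<le> r0")
    case True
    then show ?thesis using that fin by simp
  next
    case False
    have "Min (R \<inter> {..r0}) \<le> r0" using r0 fin by simp
    then show ?thesis using False by simp
  qed
  ultimately show ?thesis by (rule that)
qed

text \<open>\<open>R\<close> may be infinite, as the final run of 0's is, so the letters are counted
  by induction on \<open>k\<close>: the next one is the least element not yet taken.\<close>

lemma card_first_letters:
  assumes b: "bdd_below R" and k: "enat k \<le> run_length R"
  shows "finite (first_letters k R) \<and> card (first_letters k R) = k"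
  using k
proof (induction k)
  case 0
  then show ?case by (simp add: first_letters_def)
next
  case (Suc k)
  let ?F = "first_letters k R"
  have "enat k \<le> enat (Suc k)" by simp
  then have IH: "finite ?F" "card ?F = k" using Suc order_trans by blast+
  have "R - ?F \<noteq> {}"
  proof
    assume "R - ?F = {}"
    then have "R = ?F" by (auto simp: first_letters_def)
    then have "run_length R = enat k" using IH by (metis run_length_def)
    then show False using Suc.prems by simp
  qed
  moreover have "bdd_below (R - ?F)" using b by (rule bdd_below_mono) auto
  ultimately obtain m where m: "m \<in> R - ?F" "\<And>r. r \<in> R - ?F \<Longrightarrow> m \<le> r"
    using first_element by metis
  have fin: "finite {s \<in> R. s < r}" for r
  proof -
    obtain m where "\<And>r. r \<in> R \<Longrightarrow> m \<le> r" using b by (auto simp: bdd_below_def)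
    then have "{s \<in> R. s < r} \<subseteq> {m..r}" by auto
    then show ?thesis by (meson finite_atLeastAtMost_int finite_subset)
  qed
  have mono: "rank R r \<le> rank R s" if "r \<le> s" for r s
    unfolding rank_def using fin that by (intro card_mono) auto
  \<comment> \<open>Everything in \<open>R\<close> below the least remaining letter has been taken,
    so that letter has rank \<open>k\<close>.\<close>
  have eq: "{s \<in> R. s < m} = ?F"
  proof
    show "{s \<in> R. s < m} \<subseteq> ?F" using m(2) by fastforce
    show "?F \<subseteq> {s \<in> R. s < m}"
    proof
      fix s assume "s \<in> ?F"
      then have "s \<in> R" "rank R s < k" by (auto simp: first_letters_eq[OF b])
      moreover have "k \<le> rank R m" using m by (auto simp: first_letters_eq[OF b])
      ultimately show "s \<in> {s \<in> R. s < m}" using mono[of m s] by force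
    qed
  qed
  then have rm: "rank R m = k" by (simp add: rank_def IH)
  have "first_letters (Suc k) R = insert m ?F"
  proof
    show "insert m ?F \<subseteq> first_letters (Suc k) R" using rm m(1) by (auto simp: first_letters_eq[OF b])
    show "first_letters (Suc k) R \<subseteq> insert m ?F"
    proof
      fix r assume r: "r \<in> first_letters (Suc k) R"
      show "r \<in> insert m ?F"
      proof (rule ccontr)
        assume "r \<notin> insert m ?F"
        then have "r \<in> R - ?F" "r \<noteq> m" using r by (auto simp: first_letters_eq[OF b])
        then have "m < r" using m(2) by force
        then have "card (insert m {s \<in> R. s < m}) \<le> card {s \<in> R. s < r}"
          using m(1) fin by (intro card_mono) auto
        moreover have "card (insert m {s \<in> R. s < m}) = Suc k" using fin rm by (simp add: rank_def)
        ultimately show False using r by (auto simp: first_letters_eq[OF b] rank_def)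
      qed
    qed
  qed
  then show ?case using IH m(1) by simp
qed

section \<open>Levels along the Takahashi--Satsuma algorithm\<close>

lemma Omega_fin_bound: "\<eta> \<in> Omega_fin \<Longrightarrow> \<exists>N. \<forall>x>N. \<eta> x = 0"
proof -
  assume "\<eta> \<in> Omega_fin"
  then have "(\<lambda>n. real (\<eta> (Suc n))) \<longlonglongrightarrow> 0"
    unfolding Omega_fin_def by (intro summable_LIMSEQ_zero) simp
  then have "eventually (\<lambda>n. real (\<eta> (Suc n)) < 1) sequentially"
    by (rule order_tendstoD) simp
  then obtain N where N: "\<And>n. n \<ge> N \<Longrightarrow> real (\<eta> (Suc n)) < 1"
    by (auto simp: eventually_sequentially)
  have "\<eta> x = 0" if "x > N" for x using N[of "x - 1"] that by simp
  then show ?thesis by blast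
qed

lemma Omega_fin_values: "\<eta> \<in> Omega_fin \<Longrightarrow> x \<ge> 1 \<Longrightarrow> \<eta> x = 0 \<or> \<eta> x = 1"
  by (auto simp: Omega_fin_def Omega_def Pi_def)

lemma two_sided_values: "\<eta> \<in> Omega_fin \<Longrightarrow> two_sided \<eta> y = 0 \<or> two_sided \<eta> y = 1"
  using Omega_fin_values[of \<eta> "nat y"] by (auto simp: two_sided_def)

lemma finite_ones: "\<eta> \<in> Omega_fin \<Longrightarrow> finite {y. two_sided \<eta> y = 1}"
proof -
  assume "\<eta> \<in> Omega_fin"
  then obtain N where N: "\<forall>x>N. \<eta> x = 0" using Omega_fin_bound by blast
  have "{y. two_sided \<eta> y = 1} \<subseteq> {1..int N}"
  proof
    fix y assume "y \<in> {y. two_sided \<eta> y = 1}"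
    then have y: "y \<ge> 1" "\<eta> (nat y) = 1" by (auto simp: two_sided_def split: if_splits)
    then have "\<not> N < nat y" using N by fastforce
    with y show "y \<in> {1..int N}" by auto
  qed
  then show ?thesis by (rule finite_subset) simp
qed

lemma adjacentI:
  "x \<in> U \<Longrightarrow> y \<in> U \<Longrightarrow> x < y \<Longrightarrow> (\<And>z. z \<in> U \<Longrightarrow> x < z \<Longrightarrow> z < y \<Longrightarrow> False) \<Longrightarrow> adjacent U x y"
  unfolding adjacent_def disjoint_iff by (auto simp del: disjoint_iff)

lemma adjacentD: "adjacent U x y \<Longrightarrow> z \<in> U \<Longrightarrow> z \<le> x \<or> y \<le> z"
proof (rule ccontr)
  assume *: "adjacent U x y" "z \<in> U" "\<not> (z \<le> x \<or> y \<le> z)"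
  then have "{x<..<y} \<inter> U = {}" by (simp add: adjacent_def)
  moreover have "z \<in> {x<..<y}" using *(3) by simp
  ultimately show False using *(2) by blast
qed

text \<open>The letters crossed out between two consecutive uncrossed sites have no net effect on the
  carrier, and touch only seats below the one touched by the last uncrossed letter.\<close>

definition transparent :: "(nat \<Rightarrow> nat) \<Rightarrow> int set \<Rightarrow> bool" where
  "transparent \<eta> U \<longleftrightarrow> {..0} \<subseteq> U \<and> finite (- U) \<and>
     (\<forall>x y. adjacent U x y \<longrightarrow> seats \<eta> (nat (y - 1)) = seats \<eta> (nat x) \<and>
        (\<forall>z. x < z \<and> z < y \<longrightarrow> level \<eta> z < level \<eta> x))"

lemma transparent_seats: "transparent \<eta> U \<Longrightarrow> adjacent U x y \<Longrightarrow> seats \<eta> (nat (y - 1)) = seats \<eta> (nat x)"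
  by (simp add: transparent_def)

lemma transparent_level: "transparent \<eta> U \<Longrightarrow> adjacent U x y \<Longrightarrow> x < z \<Longrightarrow> z < y \<Longrightarrow> level \<eta> z < level \<eta> x"
  by (simp add: transparent_def)

lemma transparent_nonpos: "transparent \<eta> U \<Longrightarrow> x \<le> 0 \<Longrightarrow> x \<in> U"
  by (auto simp: transparent_def)

lemma transparent_UNIV: "transparent \<eta> UNIV"
proof -
  have "y = x + 1" if "adjacent UNIV x y" for x y :: int
  proof (rule ccontr)
    assume "y \<noteq> x + 1"
    then show False using adjacentD[OF that, of "x + 1"] that by (auto simp: adjacent_def)
  qed
  then show ?thesis by (force simp: transparent_def)
qed

lemma last_element:
  fixes T :: "int set"
  assumes "finite T" "T \<noteq> {}" obtains m where "m \<in> T" "\<And>r. r \<in> T \<Longrightarrow> r \<le> m"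
  using Max_in[OF assms] Max_ge[OF assms(1)] that by blast

lemma adjacent_pred:
  assumes "transparent \<eta> U" "x \<in> U" "x \<ge> 1" obtains p where "adjacent U p x"
proof -
  let ?T = "{y \<in> U. 0 \<le> y \<and> y < x}"
  have fin: "finite ?T" by (rule finite_subset[of _ "{0..x}"]) auto
  have "0 \<in> ?T" using assms transparent_nonpos by simp
  then have "?T \<noteq> {}" by blast
  then obtain p where p: "p \<in> ?T" "\<And>r. r \<in> ?T \<Longrightarrow> r \<le> p" using last_element[OF fin] by blast
  have "adjacent U p x"
  proof (rule adjacentI)
    fix z assume "z \<in> U" "p < z" "z < x"
    then show False using p(2)[of z] p(1) by auto
  qed (use p(1) assms(2) in auto)
  then show ?thesis by (rule that)
qed

lemma transparent_unbounded: "transparent \<eta> U \<Longrightarrow> infinite {y \<in> U. x < y}"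
proof
  assume g: "transparent \<eta> U" and f: "finite {y \<in> U. x < y}"
  have "{x<..} \<subseteq> {y \<in> U. x < y} \<union> (- U)" by auto
  moreover have "finite (- U)" using g by (simp add: transparent_def)
  ultimately have "finite {x<..}" using f by (meson finite_UnI finite_subset)
  then show False using infinite_Ioi by blast
qed

lemma adjacent_succ:
  assumes "transparent \<eta> U" "x \<in> U" obtains y where "adjacent U x y"
proof -
  let ?T = "{y \<in> U. x < y}"
  have "?T \<noteq> {}" using transparent_unbounded[OF assms(1), of x] by (metis finite.emptyI)
  moreover have "bdd_below ?T" by (auto simp: bdd_below_def intro!: exI[of _ x])
  ultimately obtain y where y: "y \<in> ?T" "\<And>r. r \<in> ?T \<Longrightarrow> y \<le> r" using first_element by metis
  have "adjacent U x y"
  proof (rule adjacentI)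
    fix z assume "z \<in> U" "x < z" "z < y"
    then show False using y(2)[of z] by auto
  qed (use y(1) assms(2) in auto)
  then show ?thesis by (rule that)
qed

section \<open>Neighbours and ranks in sets of sites\<close>

lemma convex_adjacent:
  assumes "convex_in U T" "x0 \<in> T" "x \<in> T" "x0 < x" "\<And>y. y \<in> T \<Longrightarrow> y < x \<Longrightarrow> y \<le> x0"
  shows "adjacent U x0 x"
proof (rule adjacentI)
  fix z assume z: "z \<in> U" "x0 < z" "z < x"
  then have "z \<in> T" using convex_inD[OF assms(1-3), of z] by simp
  then show False using assms(5) z by fastforce
qed (use assms in \<open>auto simp: convex_in_def\<close>)

lemma rank_pred:
  assumes "finite T" "x \<in> T" "rank T x \<noteq> 0"
  obtains x0 where "x0 \<in> T" "x0 < x" "\<And>y. y \<in> T \<Longrightarrow> y < x \<Longrightarrow> y \<le> x0" "rank T x = Suc (rank T x0)"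
proof -
  have fin: "finite {y \<in> T. y < x}" using assms by simp
  have "{y \<in> T. y < x} \<noteq> {}" using assms(3) unfolding rank_def by (metis card.empty)
  then obtain x0 where x0: "x0 \<in> {y \<in> T. y < x}" "\<And>r. r \<in> {y \<in> T. y < x} \<Longrightarrow> r \<le> x0"
    using last_element[OF fin] by blast
  have "{y \<in> T. y < x} = insert x0 {y \<in> T. y < x0}"
    using x0 by (auto simp: order.order_iff_strict)
  then have "rank T x = Suc (rank T x0)" using assms(1) by (simp add: rank_def)
  then show ?thesis using that x0 by blast
qed

lemma rank_less_card: "finite T \<Longrightarrow> x \<in> T \<Longrightarrow> rank T x < card T"
  unfolding rank_def by (intro psubset_card_mono) auto

lemma rank_inj: "finite T \<Longrightarrow> x \<in> T \<Longrightarrow> y \<in> T \<Longrightarrow> rank T x = rank T y \<Longrightarrow> x = y"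
proof (rule ccontr)
  have *: "rank T x < rank T y" if "finite T" "x \<in> T" "x < y" for x y
  proof -
    have "{z \<in> T. z < x} \<subset> {z \<in> T. z < y}" using that by auto
    then show ?thesis unfolding rank_def using that(1) by (intro psubset_card_mono) auto
  qed
  assume "finite T" "x \<in> T" "y \<in> T" "rank T x = rank T y" "x \<noteq> y"
  then show False using *[of x y] *[of y x] by linarith
qed

lemma rank_surj: "finite T \<Longrightarrow> t < card T \<Longrightarrow> \<exists>x\<in>T. rank T x = t"
proof -
  assume f: "finite T" and t: "t < card T"
  have "inj_on (rank T) T" using rank_inj[OF f] by (auto simp: inj_on_def)
  then have "card (rank T ` T) = card T" by (rule card_image)
  moreover have "rank T ` T \<subseteq> {..<card T}" using rank_less_card[OF f] by auto
  ultimately have "rank T ` T = {..<card T}" by (intro card_subset_eq) auto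
  then show ?thesis using t by (metis imageE lessThan_iff)
qed

lemma rank_last: "finite T \<Longrightarrow> x \<in> T \<Longrightarrow> (\<And>y. y \<in> T \<Longrightarrow> y \<le> x) \<Longrightarrow> Suc (rank T x) = card T"
proof -
  assume T: "finite T" "x \<in> T" "\<And>y. y \<in> T \<Longrightarrow> y \<le> x"
  then have "T = insert x {y \<in> T. y < x}" by (auto simp: order.order_iff_strict)
  then have "card T = card (insert x {y \<in> T. y < x})" by simp
  then show ?thesis using T by (simp add: rank_def)
qed

text \<open>Induction on the rank: crossed-out letters between consecutive members of
  \<open>T\<close> leave the carrier as it was, so each member finds the seats below its rank
  already set to \<open>b\<close> and the seat at its rank still in the opposite state.\<close>

lemma toggle_seats:
  assumes g: "transparent \<eta> U" and T: "finite T" "convex_in U T" "\<And>x. x \<in> T \<Longrightarrow> (two_sided \<eta> x = 1) = b"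
    and m: "m \<in> T" "\<And>x. x \<in> T \<Longrightarrow> m \<le> x"
    and s: "\<And>s. s < card T \<Longrightarrow> seats \<eta> (nat (m - 1)) s = (\<not> b)" and x: "x \<in> T"
  shows "level \<eta> x = enat (rank T x) \<and>
    seats \<eta> (nat x) = (\<lambda>s. if s \<le> rank T x then b else seats \<eta> (nat (m - 1)) s)"
  using x
proof (induction "rank T x" arbitrary: x)
  case 0
  have "finite {y \<in> T. y < x}" using T(1) by simp
  then have "{y \<in> T. y < x} = {}" using 0(1) unfolding rank_def by (metis card_0_eq)
  then have "x = m" using m 0 by force
  have "0 < card T" using rank_less_card[OF T(1) m(1)] by simp
  then have l: "lowest b (seats \<eta> (nat (m - 1))) = enat 0" using s by (simp add: lowest_eq_enat_iff)
  have "seats \<eta> (nat m) = fill b (seats \<eta> (nat (m - 1)))" using seats_int[of \<eta> m] T(3)[OF m(1)] by simp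
  then show ?case using l fill_eq[OF l] T(3)[OF m(1)] 0(1) unfolding \<open>x = m\<close>
    by (auto simp: level_def)
next
  case (Suc n)
  then have "rank T x \<noteq> 0" by simp
  then obtain x0 where x0: "x0 \<in> T" "x0 < x" "\<And>y. y \<in> T \<Longrightarrow> y < x \<Longrightarrow> y \<le> x0" "rank T x = Suc (rank T x0)"
    using rank_pred[OF T(1) Suc.prems] by metis
  have IH: "seats \<eta> (nat x0) = (\<lambda>s. if s \<le> rank T x0 then b else seats \<eta> (nat (m - 1)) s)"
    using Suc.hyps x0 by simp
  have "adjacent U x0 x" using convex_adjacent[OF T(2) x0(1) Suc.prems x0(2,3)] by blast
  then have c: "seats \<eta> (nat (x - 1)) = seats \<eta> (nat x0)" by (rule transparent_seats[OF g])
  have "rank T x < card T" by (rule rank_less_card[OF T(1) Suc.prems])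
  then have l: "lowest b (seats \<eta> (nat (x - 1))) = enat (rank T x)"
    unfolding c IH lowest_eq_enat_iff using s x0(4) by auto
  have "seats \<eta> (nat x) = fill b (seats \<eta> (nat (x - 1)))" using seats_int[of \<eta> x] T(3)[OF Suc.prems] by simp
  then show ?case using l fill_eq[OF l] T(3)[OF Suc.prems] x0(4) unfolding c IH
    by (auto simp: level_def c IH fun_eq_iff)
qed

text \<open>Uncrossed predecessors lead back to the empty carrier at the origin, and the crossed-out
  stretches between them, which may contain 1's, have no net effect.\<close>

lemma zero_prefix:
  assumes g: "transparent \<eta> U" and z: "\<And>z. z \<in> U \<Longrightarrow> z \<le> p \<Longrightarrow> two_sided \<eta> z \<noteq> 1" and p: "p \<in> U"
  shows "level \<eta> p = \<infinity> \<and> seats \<eta> (nat p) = (\<lambda>_. False)"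
  using z p
proof (induction "nat p" arbitrary: p rule: less_induct)
  case less
  have w: "two_sided \<eta> p \<noteq> 1" using less.prems by simp
  have c: "seats \<eta> (nat (p - 1)) = (\<lambda>_. False)"
  proof (cases "p \<ge> 1")
    case True
    obtain q where q: "adjacent U q p" using adjacent_pred[OF g less.prems(2) True] .
    then have "q < p" "q \<in> U" by (auto simp: adjacent_def)
    then have "seats \<eta> (nat q) = (\<lambda>_. False)" using less.hyps[of q] less.prems(1) True by simp
    then show ?thesis using transparent_seats[OF g q] by simp
  qed simp
  then have "lowest False (seats \<eta> (nat (p - 1))) = \<infinity>" by (simp add: lowest_eq_infinity_iff)
  then show ?case using w c seats_int[of \<eta> p] by (simp add: level_def fill_infinity)
qed

text \<open>All sites \<open>\<le> 0\<close> are uncrossed 0's, so a run touching them has no first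
  letter.\<close>

lemma run_first_pos:
  assumes g: "transparent \<eta> U" and Q: "run (two_sided \<eta>) U Q" and m: "m \<in> Q" "\<And>x. x \<in> Q \<Longrightarrow> m \<le> x"
  shows "m \<ge> 1"
proof (rule ccontr)
  assume "\<not> m \<ge> 1"
  then have "m - 1 \<in> run_of (two_sided \<eta>) U m"
    using transparent_nonpos[OF g] by (auto simp: run_of_def two_sided_def)
  then have "m - 1 \<in> Q" using run_eq_run_of[OF Q m(1)] by simp
  then show False using m(2) by fastforce
qed

text \<open>An infinite set of integers bounded above reaches sites \<open>\<le> 0\<close>, so this
  run is the leading run of 0's.\<close>

lemma run_infinite_left:
  assumes g: "transparent \<eta> U" and Q: "run (two_sided \<eta>) U Q" "infinite Q" and p: "p \<in> Q" "\<And>x. x \<in> Q \<Longrightarrow> x \<le> p"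
    and z: "z \<in> U" "z \<le> p"
  shows "two_sided \<eta> z = 0 \<and> z \<in> Q"
proof -
  have "\<not> Q \<subseteq> {1..p}" using Q(2) finite_subset by blast
  then obtain y where y: "y \<in> Q" "y \<le> 0" using p by fastforce
  have n: "\<not> z < y" if "\<not> z \<in> Q"
  proof
    assume "z < y"
    then have "z \<in> run_of (two_sided \<eta>) U y"
      using y z by (auto simp: run_of_def two_sided_def)
    then show False using run_eq_run_of[OF Q(1) y(1)] that by simp
  qed
  then have zQ: "z \<in> Q" using convex_inD[OF run_convex[OF Q(1)] y(1) p(1)] z by fastforce
  then have "two_sided \<eta> z = two_sided \<eta> y" using run_letter[OF Q(1)] y by blast
  then show ?thesis using y zQ by (simp add: two_sided_def)
qed

lemma adjacent_same_run:
  assumes "adjacent U p m" "w p = w m" "run w U Q" "m \<in> Q" shows "p \<in> Q"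
proof -
  have "w z = w m" if "z \<in> U" "p \<le> z" "z \<le> m" for z
  proof -
    have "z = p \<or> z = m" using adjacentD[OF assms(1) that(1)] that by auto
    then show ?thesis using assms(2) by auto
  qed
  moreover have "p \<in> U" "p < m" using assms(1) by (auto simp: adjacent_def)
  ultimately have "p \<in> run_of w U m" by (simp add: run_of_def)
  then show ?thesis using run_eq_run_of[OF assms(3,4)] by simp
qed

text \<open>Every run before the selected one is shorter than its predecessor, so the seats it toggles
  were all set the other way by that predecessor.\<close>

lemma seats_before_run:
  assumes \<eta>: "\<eta> \<in> Omega_fin" and g: "transparent \<eta> U" and sel: "selected_run (two_sided \<eta>) U P R"
    and Q: "run (two_sided \<eta>) U Q" "finite Q" "\<And>q r. q \<in> Q \<Longrightarrow> r \<in> R \<Longrightarrow> q < r"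
    and m: "m \<in> Q" "\<And>x. x \<in> Q \<Longrightarrow> m \<le> x" and p: "adjacent U p m"
  shows "(\<forall>s<card Q. seats \<eta> (nat (m - 1)) s = (two_sided \<eta> m \<noteq> 1)) \<and> enat (card Q) \<le> level \<eta> p"
  using Q m p
proof (induction "nat m" arbitrary: Q m p rule: less_induct)
  case less
  let ?w = "two_sided \<eta>"
  let ?Q' = "run_of ?w U p"
  note Q = less.prems(1-3) and m = less.prems(4,5) and p = less.prems(6)
  have pU: "p \<in> U" and pm: "p < m" using p by (auto simp: adjacent_def)
  have ne: "?w p \<noteq> ?w m" using adjacent_same_run[OF p _ Q(1) m(1)] m(2) pm by force
  have Qm: "Q = run_of ?w U m" by (rule run_eq_run_of[OF Q(1) m(1)])
  have pre: "preceding_run ?w U ?Q' Q" unfolding Qm by (rule adjacent_preceding[OF p ne])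
  have R: "R \<noteq> {}" using sel run_nonempty by (auto simp: selected_run_def eligible_run_def preceding_run_def)
  then obtain r where r: "r \<in> R" by blast
  \<comment> \<open>An eligible run left of \<open>R\<close> would contradict the choice of
    \<open>R\<close> as the leftmost one. Hence \<open>Q\<close> is strictly shorter than its
    predecessor.\<close>
  have "\<not> eligible_run ?w U ?Q' Q"
  proof
    assume "eligible_run ?w U ?Q' Q"
    then have "Q = R \<or> (\<forall>r\<in>R. \<forall>r'\<in>Q. r < r')" using sel by (simp add: selected_run_def)
    then show False using Q(3)[OF m(1)] r m(1) by fastforce
  qed
  then have len: "enat (card Q) < run_length ?Q'" using pre Q(2) by (simp add: eligible_run_def run_length_def)
  have Q': "run ?w U ?Q'" and pQ': "p \<in> ?Q'" using pU by (auto intro: run_run_of run_of_self)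
  have last: "x \<le> p" if "x \<in> ?Q'" for x
  proof -
    have "x < m" using preceding_run_less[OF pre that m(1)] .
    moreover have "x \<in> U" using that run_subset[OF Q'] by blast
    ultimately show ?thesis using p by (force simp: adjacent_def)
  qed
  have c: "seats \<eta> (nat (m - 1)) = seats \<eta> (nat p)" by (rule transparent_seats[OF g p])
  show ?case
  proof (cases "finite ?Q'")
    case False
    \<comment> \<open>Here the predecessor is the leading run of 0's, so the carrier is empty and
      \<open>Q\<close> consists of 1's.\<close>
    have z: "two_sided \<eta> z = 0" if "z \<in> U" "z \<le> p" for z
      using run_infinite_left[OF g Q' False pQ' _ that] last by blast
    have "level \<eta> p = \<infinity> \<and> seats \<eta> (nat p) = (\<lambda>_. False)"
      by (rule zero_prefix[OF g _ pU]) (simp add: z)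
    moreover have "?w m = 1" using z[OF pU] ne two_sided_values[OF \<eta>, of m] by auto
    ultimately show ?thesis using c by simp
  next
    case True
    then have "bdd_below ?Q'" by simp
    then obtain m' where m': "m' \<in> ?Q'" "\<And>x. x \<in> ?Q' \<Longrightarrow> m' \<le> x"
      using first_element run_nonempty[OF Q'] by metis
    have "m' \<ge> 1" by (rule run_first_pos[OF g Q' m'])
    moreover have "m' \<in> U" using m'(1) run_subset[OF Q'] by blast
    ultimately obtain p' where p': "adjacent U p' m'" using adjacent_pred[OF g] by metis
    have lt: "nat m' < nat m" using preceding_run_less[OF pre m'(1) m(1)] \<open>m' \<ge> 1\<close> by simp
    have before: "q < r" if "q \<in> ?Q'" "r \<in> R" for q r
      using preceding_run_less[OF pre that(1) m(1)] Q(3)[OF m(1) that(2)] by simp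
    have IH: "\<forall>s<card ?Q'. seats \<eta> (nat (m' - 1)) s = (?w m' \<noteq> 1)"
      using less.hyps[OF lt Q' True before m' p'] by simp
    have lets: "(?w x = 1) = (?w m' = 1)" if "x \<in> ?Q'" for x using run_letter[OF Q' that m'(1)] by simp
    \<comment> \<open>The predecessor flips \<open>card ?Q'\<close> seats, more than
      \<open>Q\<close> has letters; its last letter has level \<open>card ?Q' - 1\<close>, which is
      at least \<open>card Q\<close>.\<close>
    have t: "level \<eta> p = enat (rank ?Q' p) \<and>
       seats \<eta> (nat p) = (\<lambda>s. if s \<le> rank ?Q' p then ?w m' = 1 else seats \<eta> (nat (m' - 1)) s)"
      by (rule toggle_seats[OF g True run_convex[OF Q'] lets m' _ pQ']) (use IH in auto)
    have rk: "Suc (rank ?Q' p) = card ?Q'" by (rule rank_last[OF True pQ' last])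
    have "card Q < card ?Q'" using len True by (simp add: run_length_def)
    moreover have "(?w m' = 1) = (?w m \<noteq> 1)"
      using ne two_sided_values[OF \<eta>, of m] two_sided_values[OF \<eta>, of p] lets[OF pQ'] by auto
    ultimately show ?thesis using t rk c by auto
  qed
qed

text \<open>\<open>P\<close> and \<open>F\<close> are the two halves of a soliton in the state
  \<open>U\<close> in which it is crossed out. The outside neighbours \<open>x\<close> and
  \<open>y\<close> force \<open>m\<close> and \<open>n\<close> to be its first and last letters. The
  clause about them is what makes crossing out harmless: the carrier returns to its former state,
  and the letter before the soliton has a level that no letter of the soliton attains.\<close>

definition halves :: "(nat \<Rightarrow> nat) \<Rightarrow> int set \<Rightarrow> nat \<Rightarrow> int set \<Rightarrow> int set \<Rightarrow> bool" where
  "halves \<eta> U k P F \<longleftrightarrow> finite P \<and> finite F \<and> card P = k \<and> card F = k \<and> k \<ge> 1 \<and>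
     (\<forall>p\<in>P. \<forall>f\<in>F. p < f \<and> two_sided \<eta> p \<noteq> two_sided \<eta> f) \<and>
     convex_in U P \<and> convex_in U F \<and> convex_in U (P \<union> F) \<and>
     (\<forall>x\<in>P. level \<eta> x = enat (rank P x)) \<and> (\<forall>x\<in>F. level \<eta> x = enat (rank F x)) \<and>
     (\<forall>x y m n. adjacent U x m \<and> m \<in> P \<and> n \<in> F \<and> adjacent U n y \<and> y \<notin> P \<union> F \<and> x \<notin> P \<union> F \<longrightarrow>
        seats \<eta> (nat n) = seats \<eta> (nat x) \<and> enat k \<le> level \<eta> x) \<and> P \<union> F \<subseteq> {1..}"

text \<open>By \<open>seats_before_run\<close> the first half meets the seats
  \<open>0, ..., k - 1\<close> in the opposite state and flips them; the second half, carrying the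
  other letter, flips them back.\<close>

lemma ts_round_halves:
  assumes \<eta>: "\<eta> \<in> Omega_fin" and g: "transparent \<eta> U" and rd: "ts_round (two_sided \<eta>) U k G"
  obtains P F where "G = P \<union> F" "halves \<eta> U k P F"
proof -
  let ?w = "two_sided \<eta>"
  obtain P R where sel: "selected_run ?w U P R" and k: "run_length P = enat k"
    and G: "G = last_letters k P \<union> first_letters k R"
    using rd by (auto simp: ts_round_def)
  have pre: "preceding_run ?w U P R" and le: "run_length P \<le> run_length R"
    using sel by (auto simp: selected_run_def eligible_run_def)
  have run: "run ?w U P" "run ?w U R" using pre by (auto simp: preceding_run_def)
  have P: "finite P" "card P = k" using k by (auto simp: run_length_def split: if_splits)
  define F where "F = first_letters k R"
  have GP: "G = P \<union> F" unfolding G F_def last_letters_eq[OF P] ..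
  have "P \<noteq> {}" using run_nonempty[OF run(1)] .
  then have k1: "k \<ge> 1" using P by (simp add: Suc_leI card_gt_0_iff flip: P(2))
  have "bdd_below P" using P by simp
  then obtain m where m: "m \<in> P" "\<And>x. x \<in> P \<Longrightarrow> m \<le> x" using first_element \<open>P \<noteq> {}\<close> by metis
  obtain l where l: "l \<in> P" "\<And>x. x \<in> P \<Longrightarrow> x \<le> l" by (rule last_element[OF P(1) \<open>P \<noteq> {}\<close>]) blast
  have bR: "bdd_below R" using preceding_run_less[OF pre m(1)] by (auto simp: bdd_below_def intro!: exI[of _ m] less_imp_le)
  have F: "finite F" "card F = k" using card_first_letters[OF bR, of k] le k by (auto simp: F_def)
  have FR: "F \<subseteq> R" by (auto simp: F_def first_letters_def)
  have m1: "m \<ge> 1" by (rule run_first_pos[OF g run(1) m])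
  have mU: "m \<in> U" using m(1) run_subset[OF run(1)] by blast
  obtain p0 where p0: "adjacent U p0 m" using adjacent_pred[OF g mU m1] .
  have sb: "(\<forall>s<card P. seats \<eta> (nat (m - 1)) s = (?w m \<noteq> 1)) \<and> enat (card P) \<le> level \<eta> p0"
    by (rule seats_before_run[OF \<eta> g sel run(1) P(1) _ m p0]) (rule preceding_run_less[OF pre])
  have tP: "level \<eta> x = enat (rank P x) \<and>
     seats \<eta> (nat x) = (\<lambda>s. if s \<le> rank P x then ?w m = 1 else seats \<eta> (nat (m - 1)) s)" if "x \<in> P" for x
    by (rule toggle_seats[OF g P(1) run_convex[OF run(1)] _ m _ that]) (use run_letter[OF run(1) _ m(1)] sb in auto)
  \<comment> \<open>\<open>F\<close> is an initial segment of \<open>R\<close>; this gives the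
    convexity of \<open>F\<close> and of \<open>P \<union> F\<close>.\<close>
  have Finit: "y \<in> F" if "x \<in> F" "y \<in> R" "y \<le> x" for x y
  proof -
    obtain c where c: "\<And>r. r \<in> R \<Longrightarrow> c \<le> r" using bR by (auto simp: bdd_below_def)
    have "finite {s \<in> R. s < x}" by (rule finite_subset[of _ "{c..x}"]) (use c in auto)
    then have "rank R y \<le> rank R x" unfolding rank_def using that(3) by (intro card_mono) auto
    then show ?thesis using that unfolding F_def first_letters_eq[OF bR] by simp
  qed
  have cF: "convex_in U F"
    unfolding convex_in_def
  proof (intro conjI ballI subsetI)
    show "x \<in> U" if "x \<in> F" for x using that FR run_subset[OF run(2)] by blast
    fix a b z assume ab: "a \<in> F" "b \<in> F" and z: "z \<in> {a..b} \<inter> U"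
    then have "z \<in> R" using convex_inD[OF run_convex[OF run(2)], of a b z] FR by auto
    then show "z \<in> F" using Finit[OF ab(2)] z by simp
  qed
  have cG: "convex_in U (P \<union> F)"
    unfolding convex_in_def
  proof (intro conjI ballI subsetI)
    show "x \<in> U" if "x \<in> P \<union> F" for x using that FR run_subset run by blast
    fix a b z assume ab: "a \<in> P \<union> F" "b \<in> P \<union> F" and z: "z \<in> {a..b} \<inter> U"
    then have "z \<in> P \<union> R" using convex_inD[OF preceding_run_convex[OF pre], of a b z] FR by auto
    moreover have "z \<in> F" if "z \<in> R"
    proof -
      have "b \<in> F" using ab(2) preceding_run_less[OF pre _ that, of b] z by auto
      then show ?thesis using Finit that z by simp
    qed
    ultimately show "z \<in> P \<union> F" by blast
  qed
  have "F \<noteq> {}" using F k1 by auto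
  moreover have "bdd_below F" using F by simp
  ultimately obtain f where f: "f \<in> F" "\<And>x. x \<in> F \<Longrightarrow> f \<le> x" using first_element by metis
  have PF: "p < x \<and> ?w p \<noteq> ?w x" if "p \<in> P" "x \<in> F" for p x
    using that FR preceding_run_less[OF pre] preceding_run_letters[OF pre] by blast
  have adj: "adjacent U l f"
    by (rule convex_adjacent[OF cG]) (use l f PF in force)+
  have rl: "Suc (rank P l) = card P" by (rule rank_last[OF P(1) l])
  have wf: "(?w f = 1) = (?w m \<noteq> 1)"
    using PF[OF m(1) f(1)] two_sided_values[OF \<eta>, of m] two_sided_values[OF \<eta>, of f] by auto
  \<comment> \<open>\<open>f\<close> is the uncrossed letter right after the last one of
    \<open>P\<close>, so the second half starts with exactly these \<open>k\<close> seats
    flipped.\<close>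
  have sf: "seats \<eta> (nat (f - 1)) = (\<lambda>s. if s < k then ?w m = 1 else seats \<eta> (nat (m - 1)) s)"
    using transparent_seats[OF g adj] tP[OF l(1)] rl P(2) by (auto simp: fun_eq_iff)
  have tF: "level \<eta> x = enat (rank F x) \<and>
     seats \<eta> (nat x) = (\<lambda>s. if s \<le> rank F x then ?w f = 1 else seats \<eta> (nat (f - 1)) s)" if "x \<in> F" for x
  proof (rule toggle_seats[OF g F(1) cF _ f _ that])
    show "(?w y = 1) = (?w f = 1)" if "y \<in> F" for y
      using run_letter[OF run(2) subsetD[OF FR that] subsetD[OF FR f(1)]] by simp
    show "seats \<eta> (nat (f - 1)) s = (\<not> (?w f = 1))" if "s < card F" for s
      using that F(2) wf by (simp add: sf)
  qed
  have ends: "seats \<eta> (nat n) = seats \<eta> (nat x) \<and> enat k \<le> level \<eta> x"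
    if h: "adjacent U x m'" "m' \<in> P" "n \<in> F" "adjacent U n y" "y \<notin> P \<union> F" "x \<notin> P \<union> F" for x y m' n
  proof -
    have "m' = m"
    proof (rule ccontr)
      assume "m' \<noteq> m"
      then have "m < m'" using m h by force
      then have "m \<le> x" using h(1) mU by (force simp: adjacent_def)
      then have "x \<in> P" using convex_inD[OF run_convex[OF run(1)] m(1) h(2)] h(1) by (simp add: adjacent_def)
      then show False using h by blast
    qed
    moreover have "x' = p0" if "adjacent U x' m" for x' using p0 that
      by (metis adjacent_def disjoint_iff greaterThanLessThan_iff linorder_neqE)
    ultimately have x: "x = p0" using h by simp
    have nlast: "z \<le> n" if "z \<in> F" for z
    proof (rule ccontr)
      assume "\<not> z \<le> n"
      moreover have "z \<in> U" using that cF by (auto simp: convex_in_def)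
      ultimately have "y \<le> z" using h(4) by (force simp: adjacent_def)
      then have "y \<in> F" using convex_inD[OF cF h(3) that, of y] h(4) by (simp add: adjacent_def)
      then show False using h by blast
    qed
    \<comment> \<open>At the last rank \<open>k - 1\<close> each of the \<open>k\<close> seats has
      been flipped twice.\<close>
    have "Suc (rank F n) = k" using rank_last[OF F(1) h(3) nlast] F(2) by simp
    then have "seats \<eta> (nat n) = seats \<eta> (nat (m - 1))"
      using tF[OF h(3)] sf sb wf P(2) by (auto simp: fun_eq_iff)
    also have "\<dots> = seats \<eta> (nat x)" unfolding x by (rule transparent_seats[OF g p0])
    finally show ?thesis using sb P(2) x by simp
  qed
  have pos: "P \<union> F \<subseteq> {1..}" using m m1 PF by force
  have "halves \<eta> U k P F" unfolding halves_def
    using P F k1 PF run_convex[OF run(1)] cF cG tP tF ends pos by blast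
  then show ?thesis using that GP by blast
qed

text \<open>Take the last member \<open>y\<close> of \<open>G\<close> up to \<open>z\<close>: either
  \<open>y = z\<close>, or \<open>z\<close> lies in the gap after \<open>y\<close>, where
  transparency keeps levels below that of \<open>y\<close>.\<close>

lemma level_inside:
  assumes g: "transparent \<eta> U" and G: "finite G" "\<And>x. x \<in> G \<Longrightarrow> level \<eta> x < enat k" "G \<subseteq> U"
    and z: "x \<in> G" "x \<le> z" "{x..z} \<inter> U \<subseteq> G"
  shows "level \<eta> z < enat k"
proof -
  let ?T = "{y \<in> G. y \<le> z}"
  have "finite ?T" "?T \<noteq> {}" using G z by auto
  then obtain y where y: "y \<in> ?T" "\<And>r. r \<in> ?T \<Longrightarrow> r \<le> y" using last_element by metis
  show ?thesis
  proof (cases "y = z")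
    case True
    then show ?thesis using G y by auto
  next
    case False
    then have "y < z" "y \<in> U" using y G by auto
    then obtain u where u: "adjacent U y u" using adjacent_succ[OF g] by metis
    have "z < u"
    proof (rule ccontr)
      assume "\<not> z < u"
      then have "u \<in> {x..z} \<inter> U" using u y(2)[of x] z by (auto simp: adjacent_def)
      then have "u \<in> ?T" using z(3) by auto
      then have "u \<le> y" by (rule y(2))
      then show False using u by (simp add: adjacent_def)
    qed
    then have "level \<eta> z < level \<eta> y" using transparent_level[OF g u \<open>y < z\<close>] by simp
    then show ?thesis using G(2)[of y] y(1) by (auto intro: less_trans)
  qed
qed

lemma halves_level: "halves \<eta> U k P F \<Longrightarrow> x \<in> P \<union> F \<Longrightarrow> level \<eta> x < enat k"
  unfolding halves_def using rank_less_card by (metis UnE enat_ord_simps(2))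

text \<open>A new gap is either an old one or the whole soliton together with the old gaps around
  and inside it. In the latter case the levels from the soliton onwards are below \<open>k\<close>,
  hence below that of the letter preceding it.\<close>

lemma transparent_diff:
  assumes g: "transparent \<eta> U" and b: "halves \<eta> U k P F" shows "transparent \<eta> (U - (P \<union> F))"
proof -
  let ?G = "P \<union> F"
  have fin: "finite ?G" and cv: "convex_in U ?G" and pos: "?G \<subseteq> {1..}" and GU: "?G \<subseteq> U"
    and cP: "convex_in U P" and cF: "convex_in U F"
    using b by (auto simp: halves_def convex_in_def)
  have PF: "p < f" if "p \<in> P" "f \<in> F" for p f using b that by (simp add: halves_def)
  have ne: "P \<noteq> {}" "F \<noteq> {}" using b by (auto simp: halves_def)
  have "{..0} \<subseteq> U - ?G" using g pos by (auto simp: transparent_def)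
  moreover have "- (U - ?G) = - U \<union> ?G" by blast
  then have "finite (- (U - ?G))" using fin g by (simp add: transparent_def)
  moreover have "seats \<eta> (nat (y - 1)) = seats \<eta> (nat x) \<and>
        (\<forall>z. x < z \<and> z < y \<longrightarrow> level \<eta> z < level \<eta> x)" if a: "adjacent (U - ?G) x y" for x y
  proof (cases "{x<..<y} \<inter> U = {}")
    case True
    then have "adjacent U x y" using a by (auto simp: adjacent_def)
    then show ?thesis using g by (simp add: transparent_def)
  next
    case False
    have xy: "x \<in> U" "x \<notin> ?G" "y \<in> U" "y \<notin> ?G" "x < y" using a by (auto simp: adjacent_def)
    have sub: "{x<..<y} \<inter> U \<subseteq> ?G" using a by (auto simp: adjacent_def)
    from False obtain h where "h \<in> {x<..<y} \<inter> U" by blast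
    then have h: "h \<in> ?G" "x < h" "h < y" using sub by auto
    \<comment> \<open>If \<open>x\<close> or \<open>y\<close> lay between two letters of the
      soliton, convexity would make it one of them.\<close>
    have inside: "x < h' \<and> h' < y" if "h' \<in> ?G" for h'
      using convex_inD[OF cv that h(1), of x] convex_inD[OF cv h(1) that, of y] xy h by force
    have "bdd_below P" using b by (simp add: halves_def)
    then obtain m where m: "m \<in> P" "\<And>x. x \<in> P \<Longrightarrow> m \<le> x" using first_element ne(1) by metis
    have "finite F" using b by (simp add: halves_def)
    then obtain n where n: "n \<in> F" "\<And>x. x \<in> F \<Longrightarrow> x \<le> n" using last_element ne(2) by metis
    have mG: "m \<le> z" if "z \<in> ?G" for z using that m PF[OF m(1)] by force
    have nG: "z \<le> n" if "z \<in> ?G" for z using that n PF[OF _ n(1)] by force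
    have xm: "adjacent U x m"
    proof (rule adjacentI)
      fix z assume "z \<in> U" "x < z" "z < m"
      moreover have "m < y" using inside m(1) by blast
      ultimately have "z \<in> {x<..<y} \<inter> U" by simp
      then have "z \<in> ?G" using sub by blast
      then show False using mG[of z] \<open>z < m\<close> by simp
    qed (use xy inside[of m] m(1) GU in auto)
    have ny: "adjacent U n y"
    proof (rule adjacentI)
      fix z assume "z \<in> U" "n < z" "z < y"
      moreover have "x < n" using inside n(1) by blast
      ultimately have "z \<in> {x<..<y} \<inter> U" by simp
      then have "z \<in> ?G" using sub by blast
      then show False using nG[of z] \<open>n < z\<close> by simp
    qed (use xy inside[of n] n(1) GU in auto)
    have e: "seats \<eta> (nat n) = seats \<eta> (nat x) \<and> enat k \<le> level \<eta> x"
      using b xm m(1) n(1) ny xy unfolding halves_def by blast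
    have "level \<eta> z < level \<eta> x" if z: "x < z" "z < y" for z
    proof (cases "z < m")
      case True
      then show ?thesis using transparent_level[OF g xm] z by simp
    next
      case False
      have "{m..z} \<inter> U \<subseteq> ?G"
      proof
        fix u assume u: "u \<in> {m..z} \<inter> U"
        then have "u \<in> {x<..<y}" using z inside[of m] m(1) by auto
        then show "u \<in> ?G" using sub u by blast
      qed
      then have "level \<eta> z < enat k"
        using level_inside[OF g fin halves_level[OF b] GU, of m z] m(1) False by simp
      then show ?thesis using e by (auto intro: less_le_trans)
    qed
    moreover have "seats \<eta> (nat (y - 1)) = seats \<eta> (nat x)" using transparent_seats[OF g ny] e by simp
    ultimately show ?thesis by blast
  qed
  ultimately show ?thesis by (simp add: transparent_def)
qed

lemma ts_uncrossed_good:
  assumes "\<eta> \<in> Omega_fin" "ts_uncrossed (two_sided \<eta>) U" shows "transparent \<eta> U"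
  using assms(2)
proof induction
  case start
  show ?case by (rule transparent_UNIV)
next
  case (cross U k G)
  then show ?case using ts_round_halves[OF assms(1)] transparent_diff by metis
qed

text \<open>The run after the last uncrossed 1 is an infinite run of 0's, hence eligible; eligible
  runs lie in sites \<open>\<ge> 1\<close>, so there is a leftmost one.\<close>

lemma ts_round_exists:
  assumes \<eta>: "\<eta> \<in> Omega_fin" and g: "transparent \<eta> U" and u: "u \<in> U" "two_sided \<eta> u = 1"
  shows "\<exists>k G. ts_round (two_sided \<eta>) U k G"
proof -
  let ?w = "two_sided \<eta>"
  have fin1: "finite {y \<in> U. ?w y = 1}" by (rule finite_subset[OF _ finite_ones[OF \<eta>]]) auto
  have ne1: "{y \<in> U. ?w y = 1} \<noteq> {}" using u by blast
  obtain m where m: "m \<in> {y \<in> U. ?w y = 1}" "\<And>y. y \<in> {y \<in> U. ?w y = 1} \<Longrightarrow> y \<le> m"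
    by (rule last_element[OF fin1 ne1]) blast
  then obtain n where n: "adjacent U m n" using adjacent_succ[OF g, of m] by auto
  have z: "?w y \<noteq> 1" if "y \<in> U" "m < y" for y using m(2)[of y] that by auto
  have wn: "?w m \<noteq> ?w n" using z[of n] n m by (auto simp: adjacent_def)
  have pre: "preceding_run ?w U (run_of ?w U m) (run_of ?w U n)" by (rule adjacent_preceding[OF n wn])
  have "{y \<in> U. n < y} \<subseteq> run_of ?w U n"
  proof
    fix y assume y: "y \<in> {y \<in> U. n < y}"
    have "?w t = 0" if "t \<in> U" "n \<le> t" for t
      using z[of t] that n two_sided_values[OF \<eta>, of t] by (auto simp: adjacent_def)
    then show "y \<in> run_of ?w U n" using y n by (auto simp: run_of_def adjacent_def)
  qed
  then have "infinite (run_of ?w U n)" using transparent_unbounded[OF g, of n] finite_subset by blast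
  then have el: "eligible_run ?w U (run_of ?w U m) (run_of ?w U n)"
    using pre by (simp add: eligible_run_def run_length_def)
  \<comment> \<open>The sites of all eligible runs; an eligible run through the least of them is the
    selected one.\<close>
  define E where "E = {r. \<exists>P R. eligible_run ?w U P R \<and> r \<in> R}"
  have "n \<in> E" unfolding E_def using el run_of_self[of n U ?w] n by (auto simp: adjacent_def)
  moreover have pos: "r \<ge> 1" if rE: "r \<in> E" for r
  proof (rule ccontr)
    assume r1: "\<not> r \<ge> 1"
    obtain P R where e: "eligible_run ?w U P R" "r \<in> R" using rE by (auto simp: E_def)
    then have pre: "preceding_run ?w U P R" by (simp add: eligible_run_def)
    have run: "run ?w U P" "run ?w U R" using pre by (auto simp: preceding_run_def)
    obtain p where p: "p \<in> P" using run_nonempty[OF run(1)] by blast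
    have "p < r" using preceding_run_less[OF pre p e(2)] .
    then show False using preceding_run_letters[OF pre p e(2)] r1 by (simp add: two_sided_def)
  qed
  then have "bdd_below E" by (auto simp: bdd_below_def)
  ultimately obtain r where r: "r \<in> E" "\<And>x. x \<in> E \<Longrightarrow> r \<le> x" using first_element by (metis empty_iff)
  obtain P R where e: "eligible_run ?w U P R" "r \<in> R" using r(1) by (auto simp: E_def)
  then have pre: "preceding_run ?w U P R" by (simp add: eligible_run_def)
  have run: "run ?w U P" "run ?w U R" using pre by (auto simp: preceding_run_def)
  have sel: "selected_run ?w U P R"
    unfolding selected_run_def
  proof (intro conjI allI impI)
    fix P' R' assume e': "eligible_run ?w U P' R'"
    have run': "run ?w U R'" using e' by (auto simp: eligible_run_def preceding_run_def)
    show "R' = R \<or> (\<forall>r\<in>R. \<forall>r'\<in>R'. r < r')"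
    proof (rule disjCI)
      assume "\<not> (\<forall>r\<in>R. \<forall>r'\<in>R'. r < r')"
      then obtain a b where ab: "a \<in> R" "b \<in> R'" "b \<le> a" by force
      then have "r \<le> b" using r(2)[of b] e' by (auto simp: E_def)
      moreover have "b \<in> U" using ab run_subset[OF run'] by blast
      ultimately have "b \<in> R" using convex_inD[OF run_convex[OF run(2)] e(2) ab(1)] ab by simp
      then show "R' = R" using run_eqI[OF run' run(2)] ab by blast
    qed
  qed (rule e(1))
  \<comment> \<open>An infinite \<open>P\<close> would reach the 0's at sites
    \<open>\<le> 0\<close>. Then \<open>R\<close> is infinite too and contains a 0, as there are
    finitely many 1's; but consecutive runs carry different letters.\<close>
  have "finite P"
  proof (rule ccontr)
    assume inf: "infinite P"
    obtain p where p: "p \<in> P" using run_nonempty[OF run(1)] by blast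
    have "infinite R" using e(1) inf by (auto simp: eligible_run_def run_length_def split: if_splits)
    then have "\<not> R \<subseteq> {y \<in> U. ?w y = 1}" using fin1 finite_subset by blast
    then obtain t where t: "t \<in> R" "?w t = 0"
      using run_subset[OF run(2)] two_sided_values[OF \<eta>] by blast
    have "\<not> P \<subseteq> {1..t}" using inf finite_subset by blast
    then obtain y where y: "y \<in> P" "y \<le> 0" using preceding_run_less[OF pre _ t(1)] by fastforce
    then show False using preceding_run_letters[OF pre y(1) t(1)] t(2) by (simp add: two_sided_def)
  qed
  then have "ts_round ?w U (card P) (last_letters (card P) P \<union> first_letters (card P) R)"
    unfolding ts_round_def using sel u by (auto simp: run_length_def)
  then show ?thesis by blast
qed

text \<open>The number of uncrossed 1's decreases, since the two halves of a soliton carry different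
  letters and one of them therefore consists of 1's.\<close>

lemma ts_terminates:
  assumes \<eta>: "\<eta> \<in> Omega_fin" and "ts_uncrossed (two_sided \<eta>) U"
  shows "\<exists>V. ts_uncrossed (two_sided \<eta>) V \<and> (\<forall>y\<in>V. two_sided \<eta> y \<noteq> 1)"
  using assms(2)
proof (induction "card {y \<in> U. two_sided \<eta> y = 1}" arbitrary: U rule: less_induct)
  case less
  note g = ts_uncrossed_good[OF \<eta> less.prems]
  show ?case
  proof (cases "\<exists>u\<in>U. two_sided \<eta> u = 1")
    case True
    then obtain k G where rd: "ts_round (two_sided \<eta>) U k G" using ts_round_exists[OF \<eta> g] by blast
    obtain P F where G: "G = P \<union> F" and b: "halves \<eta> U k P F" using ts_round_halves[OF \<eta> g rd] .
    then obtain p f where pf: "p \<in> P" "f \<in> F" "two_sided \<eta> p \<noteq> two_sided \<eta> f"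
      unfolding halves_def by (metis One_nat_def card.empty ex_in_conv not_one_le_zero)
    then obtain x where x: "x \<in> G" "two_sided \<eta> x = 1"
      using two_sided_values[OF \<eta>, of p] two_sided_values[OF \<eta>, of f] G by fastforce
    have "x \<in> U" using x ts_round_subset[OF rd] by blast
    then have "{y \<in> U - G. two_sided \<eta> y = 1} \<subset> {y \<in> U. two_sided \<eta> y = 1}" using x by blast
    moreover have "finite {y \<in> U. two_sided \<eta> y = 1}" by (rule finite_subset[OF _ finite_ones[OF \<eta>]]) auto
    ultimately have "card {y \<in> U - G. two_sided \<eta> y = 1} < card {y \<in> U. two_sided \<eta> y = 1}"
      by (rule psubset_card_mono[rotated])
    then show ?thesis using less.hyps ts_uncrossed.cross[OF less.prems rd] by blast
  next
    case False
    then show ?thesis using less.prems by blast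
  qed
qed

section \<open>Solitons and slots\<close>

text \<open>Relates the list position behind \<open>component\<close>, counted from 0, to the rank
  in which levels are expressed.\<close>

lemma nth_sorted_list_rank:
  fixes A :: "nat set"
  assumes "finite A" "i < card A"
  shows "sorted_list_of_set A ! i \<in> A" "rank (int ` A) (int (sorted_list_of_set A ! i)) = i"
proof -
  let ?xs = "sorted_list_of_set A"
  have l: "i < length ?xs" using assms by simp
  have st: "sorted_wrt (<) ?xs" by simp
  show m: "?xs ! i \<in> A" using nth_mem[OF l] assms(1) by simp
  have lt: "?xs ! a < ?xs ! b \<longleftrightarrow> a < b" if "a < length ?xs" "b < length ?xs" for a b
    using sorted_wrt_nth_less[OF st, of a b] sorted_wrt_nth_less[OF st, of b a] that
    by (metis less_asym linorder_neqE_nat order_less_irrefl)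
  have "{y \<in> A. y < ?xs ! i} = (!) ?xs ` {..<i}"
  proof
    show "{y \<in> A. y < ?xs ! i} \<subseteq> (!) ?xs ` {..<i}"
    proof
      fix y assume y: "y \<in> {y \<in> A. y < ?xs ! i}"
      then have "y \<in> set ?xs" using assms(1) by simp
      then obtain a where "a < length ?xs" "y = ?xs ! a" by (metis in_set_conv_nth)
      then show "y \<in> (!) ?xs ` {..<i}" using lt l y by auto
    qed
    show "(!) ?xs ` {..<i} \<subseteq> {y \<in> A. y < ?xs ! i}"
    proof
      fix y assume "y \<in> (!) ?xs ` {..<i}"
      then obtain a where a: "a < i" "y = ?xs ! a" by auto
      then have "y \<in> set ?xs" using l by simp
      then show "y \<in> {y \<in> A. y < ?xs ! i}" using a lt[of a i] l assms(1) by simp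
    qed
  qed
  moreover have "inj_on ((!) ?xs) {..<i}"
    by (rule inj_on_nth) (use l in auto)
  ultimately have "card {y \<in> A. y < ?xs ! i} = i" by (simp add: card_image)
  moreover have "{y \<in> int ` A. y < int (?xs ! i)} = int ` {y \<in> A. y < ?xs ! i}" by auto
  ultimately show "rank (int ` A) (int (?xs ! i)) = i" by (simp add: rank_def card_image)
qed

lemma two_sided_int: "x \<ge> 1 \<Longrightarrow> two_sided \<eta> (int x) = \<eta> x"
  by (simp add: two_sided_def)

lemma halves_rank:
  assumes "halves \<eta> U k P F"
  shows "x \<in> P \<Longrightarrow> rank (P \<union> F) x = rank P x" "x \<in> F \<Longrightarrow> rank (P \<union> F) x = k + rank F x"
proof -
  have PF: "finite P" "finite F" "card P = k" and lt: "\<And>p f. p \<in> P \<Longrightarrow> f \<in> F \<Longrightarrow> p < f"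
    using assms by (auto simp: halves_def)
  show "rank (P \<union> F) x = rank P x" if "x \<in> P"
  proof -
    have "{y \<in> P \<union> F. y < x} = {y \<in> P. y < x}" using lt[OF that] by force
    then show ?thesis unfolding rank_def by metis
  qed
  show "rank (P \<union> F) x = k + rank F x" if "x \<in> F"
  proof -
    have "{y \<in> P \<union> F. y < x} = P \<union> {y \<in> F. y < x}" "P \<inter> {y \<in> F. y < x} = {}"
      using lt[OF _ that] lt by fastforce+
    then show ?thesis using PF by (simp add: rank_def card_Un_disjoint)
  qed
qed

lemma xi_const:
  assumes "x \<le> y" "\<And>z. x < z \<Longrightarrow> z \<le> y \<Longrightarrow> level \<eta> (int z) < enat k"
  shows "xi \<eta> k y = xi \<eta> k x"
  using assms
proof (induction y rule: dec_induct)
  case (step n)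
  have "\<not> enat k \<le> level \<eta> (int (Suc n))" using step.prems[of "Suc n"] step.hyps by (simp add: not_le)
  then show ?case using step by (simp add: xi_Suc del: of_nat_Suc)
qed simp

context
  fixes \<eta> :: "nat \<Rightarrow> nat"
  assumes \<eta>: "\<eta> \<in> Omega_fin"
begin

lemma soliton_halves:
  assumes "soliton \<eta> k \<gamma>"
  obtains U P F where "transparent \<eta> U" "int ` \<gamma> = P \<union> F" "halves \<eta> U k P F"
proof -
  obtain U where U: "ts_uncrossed (two_sided \<eta>) U" "ts_round (two_sided \<eta>) U k (int ` \<gamma>)"
    using assms by (auto simp: soliton_def)
  show ?thesis
    using ts_round_halves[OF \<eta> ts_uncrossed_good[OF \<eta> U(1)] U(2)] ts_uncrossed_good[OF \<eta> U(1)] that by metis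
qed

lemma soliton_disjoint:
  assumes "soliton \<eta> k \<gamma>" "soliton \<eta> l \<delta>" "x \<in> \<gamma>" "x \<in> \<delta>"
  shows "k = l" "\<gamma> = \<delta>"
proof -
  obtain U V where "ts_uncrossed (two_sided \<eta>) U" "ts_round (two_sided \<eta>) U k (int ` \<gamma>)"
     "ts_uncrossed (two_sided \<eta>) V" "ts_round (two_sided \<eta>) V l (int ` \<delta>)"
    using assms unfolding soliton_def by blast
  from ts_round_disjoint[OF this, of "int x"] have "k = l \<and> int ` \<gamma> = int ` \<delta>" using assms by simp
  then show "k = l" "\<gamma> = \<delta>" by (simp_all add: inj_image_eq_iff)
qed

lemma soliton_basic:
  assumes "soliton \<eta> k \<gamma>"
  shows "finite \<gamma>" "card \<gamma> = 2 * k" "k \<ge> 1" "x \<in> \<gamma> \<Longrightarrow> x \<ge> 1" "x \<in> \<gamma> \<Longrightarrow> level \<eta> (int x) < enat k"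
proof -
  obtain U P F where g: "transparent \<eta> U" and G: "int ` \<gamma> = P \<union> F" and b: "halves \<eta> U k P F"
    using soliton_halves[OF assms] .
  have PF: "finite P" "finite F" "card P = k" "card F = k" "k \<ge> 1" "P \<union> F \<subseteq> {1..}"
    using b by (auto simp: halves_def)
  have "P \<inter> F = {}" using b by (fastforce simp: halves_def)
  then have "card (int ` \<gamma>) = 2 * k" using PF G by (simp add: card_Un_disjoint)
  then show "card \<gamma> = 2 * k" by (simp add: card_image)
  have "finite (int ` \<gamma>)" using G PF by simp
  then show "finite \<gamma>" by (simp add: finite_image_iff)
  show "k \<ge> 1" by (rule PF)
  assume "x \<in> \<gamma>"
  then have x: "int x \<in> P \<union> F" using G by auto
  then have "int x \<in> {1..}" using PF by blast
  then show "x \<ge> 1" by simp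
  show "level \<eta> (int x) < enat k" by (rule halves_level[OF b x])
qed

text \<open>Within each half the level is the rank in that half, and ranks in the second half are
  shifted by \<open>k\<close>.\<close>

lemma soliton_rank_level:
  assumes "soliton \<eta> k \<gamma>" "x \<in> \<gamma>"
  defines "r \<equiv> rank (int ` \<gamma>) (int x)"
  shows "level \<eta> (int x) = enat (if r < k then r else r - k)"
proof -
  obtain U P F where g: "transparent \<eta> U" and G: "int ` \<gamma> = P \<union> F" and b: "halves \<eta> U k P F"
    using soliton_halves[OF assms(1)] .
  have PF: "finite P" "finite F" "card P = k" "card F = k"
    and l: "\<And>x. x \<in> P \<Longrightarrow> level \<eta> x = enat (rank P x)" "\<And>x. x \<in> F \<Longrightarrow> level \<eta> x = enat (rank F x)"
    using b by (auto simp: halves_def)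
  have "int x \<in> P \<union> F" using assms(2) G by blast
  then show ?thesis
  proof
    assume "int x \<in> P"
    then show ?thesis using l halves_rank[OF b] rank_less_card[OF PF(1)] PF by (simp add: r_def G)
  next
    assume "int x \<in> F"
    then show ?thesis using l halves_rank[OF b] by (simp add: r_def G)
  qed
qed

lemma component_level:
  assumes "soliton \<eta> k \<gamma>" "1 \<le> l" "l \<le> k"
  shows "level \<eta> (int (component \<gamma> l)) = enat (l - 1)" "level \<eta> (int (component \<gamma> (l + k))) = enat (l - 1)"
proof -
  note s = soliton_basic[OF assms(1)]
  have c: "l - 1 < card \<gamma>" "l + k - 1 < card \<gamma>" using s(2) assms by auto
  note n = nth_sorted_list_rank[OF s(1) c(1)] nth_sorted_list_rank[OF s(1) c(2)]
  have "(if l - 1 < k then l - 1 else l - 1 - k) = l - 1"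
    "(if l + k - 1 < k then l + k - 1 else l + k - 1 - k) = l - 1" using assms by auto
  then show "level \<eta> (int (component \<gamma> l)) = enat (l - 1)" "level \<eta> (int (component \<gamma> (l + k))) = enat (l - 1)"
    using soliton_rank_level[OF assms(1) n(1)] soliton_rank_level[OF assms(1) n(3)] n(2,4)
    by (simp_all only: component_def)
qed

lemma soliton_component:
  assumes "soliton \<eta> k \<gamma>" "x \<in> \<gamma>"
  shows "\<exists>l. 1 \<le> l \<and> l \<le> k \<and> (x = component \<gamma> l \<or> x = component \<gamma> (l + k))"
proof -
  note s = soliton_basic[OF assms(1)]
  have "x \<in> set (sorted_list_of_set \<gamma>)" using s(1) assms by simp
  then obtain i where i: "i < 2 * k" "x = sorted_list_of_set \<gamma> ! i"
    using s(2) by (metis in_set_conv_nth length_sorted_list_of_set)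
  show ?thesis
  proof (cases "i < k")
    case True
    then show ?thesis using i by (intro exI[of _ "Suc i"]) (simp add: component_def)
  next
    case False
    then show ?thesis using i by (intro exI[of _ "Suc (i - k)"]) (simp add: component_def)
  qed
qed

text \<open>Each half contains one letter of level \<open>t\<close>, and exactly one half consists
  of 1's.\<close>

lemma soliton_up_ex1:
  assumes "soliton \<eta> k \<gamma>" "t < k"
  shows "\<exists>!x. x \<in> \<gamma> \<and> \<eta> x = 1 \<and> level \<eta> (int x) = enat t"
proof -
  obtain U P F where g: "transparent \<eta> U" and G: "int ` \<gamma> = P \<union> F" and b: "halves \<eta> U k P F"
    using soliton_halves[OF assms(1)] .
  have PF: "finite P" "finite F" "card P = k" "card F = k"
    and l: "\<And>x. x \<in> P \<Longrightarrow> level \<eta> x = enat (rank P x)" "\<And>x. x \<in> F \<Longrightarrow> level \<eta> x = enat (rank F x)"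
    and ne: "\<And>x y. x \<in> P \<Longrightarrow> y \<in> F \<Longrightarrow> two_sided \<eta> x \<noteq> two_sided \<eta> y"
    using b by (auto simp: halves_def)
  have w: "two_sided \<eta> (int x) = \<eta> x" if "x \<in> \<gamma>" for x using soliton_basic(4)[OF assms(1) that] by (rule two_sided_int)
  obtain p where p: "p \<in> P" "rank P p = t" using rank_surj[OF PF(1)] PF assms by metis
  obtain f where f: "f \<in> F" "rank F f = t" using rank_surj[OF PF(2)] PF assms by metis
  obtain x where x: "x \<in> {p, f}" "two_sided \<eta> x = 1"
    using ne[OF p(1) f(1)] two_sided_values[OF \<eta>, of p] two_sided_values[OF \<eta>, of f] by fastforce
  have "x \<in> int ` \<gamma>" using x p f G by auto
  then obtain x' where x': "x = int x'" "x' \<in> \<gamma>" by blast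
  show ?thesis
  proof (rule ex1I[of _ x'])
    show "x' \<in> \<gamma> \<and> \<eta> x' = 1 \<and> level \<eta> (int x') = enat t" using x x' w[OF x'(2)] l p f by auto
  next
    fix y assume y: "y \<in> \<gamma> \<and> \<eta> y = 1 \<and> level \<eta> (int y) = enat t"
    have "int y \<in> P \<union> F" "two_sided \<eta> (int y) = 1" using y w G by auto
    then have "int y \<in> P \<and> x = p \<or> int y \<in> F \<and> x = f"
      using x p f ne by (metis Un_iff insertE singletonD)
    then have "int y = x"
      using y l p f rank_inj[OF PF(1)] rank_inj[OF PF(2)] by (metis enat.inject)
    then show "y = x'" using x' by simp
  qed
qed

text \<open>No site between two letters of a \<open>k\<close>-soliton has level
  \<open>\<ge> k\<close>, whether it belongs to the soliton or was crossed out earlier.\<close>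

lemma soliton_xi_const:
  assumes "soliton \<eta> k \<gamma>" "x \<in> \<gamma>" "y \<in> \<gamma>"
  shows "xi \<eta> k x = xi \<eta> k y"
proof -
  obtain U P F where g: "transparent \<eta> U" and G: "int ` \<gamma> = P \<union> F" and b: "halves \<eta> U k P F"
    using soliton_halves[OF assms(1)] .
  have fin: "finite (P \<union> F)" and cv: "convex_in U (P \<union> F)" using b by (auto simp: halves_def)
  then have GU: "P \<union> F \<subseteq> U" by (simp add: convex_in_def)
  have *: "xi \<eta> k y = xi \<eta> k x" if "x \<in> \<gamma>" "y \<in> \<gamma>" "x \<le> y" for x y
  proof (rule xi_const[OF that(3)])
    fix z assume z: "x < z" "z \<le> y"
    have xy: "int x \<in> P \<union> F" "int y \<in> P \<union> F" using that G by auto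
    have "{int x..int z} \<inter> U \<subseteq> P \<union> F"
    proof
      fix u assume "u \<in> {int x..int z} \<inter> U"
      then show "u \<in> P \<union> F" using convex_inD[OF cv xy, of u] z by simp
    qed
    then show "level \<eta> (int z) < enat k"
      using level_inside[OF g fin halves_level[OF b] GU xy(1), of "int z"] z by simp
  qed
  show ?thesis using *[of x y] *[of y x] assms by (metis linear)
qed

text \<open>Both letters belong to the half of 1's and are neighbours there. The gap between them
  holds only levels below \<open>t\<close>, so \<open>y\<close> alone is counted.\<close>

lemma soliton_xi_Suc:
  assumes "soliton \<eta> k \<gamma>" and x: "x \<in> \<gamma>" "\<eta> x = 1" "level \<eta> (int x) = enat t"
    and y: "y \<in> \<gamma>" "\<eta> y = 1" "level \<eta> (int y) = enat (Suc t)"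
  shows "xi \<eta> (Suc t) y = Suc (xi \<eta> (Suc t) x)"
proof -
  obtain U P F where g: "transparent \<eta> U" and G: "int ` \<gamma> = P \<union> F" and b: "halves \<eta> U k P F"
    using soliton_halves[OF assms(1)] .
  have PF: "finite P" "finite F" "convex_in U P" "convex_in U F"
    and l: "\<And>x. x \<in> P \<Longrightarrow> level \<eta> x = enat (rank P x)" "\<And>x. x \<in> F \<Longrightarrow> level \<eta> x = enat (rank F x)"
    and ne: "\<And>x y. x \<in> P \<Longrightarrow> y \<in> F \<Longrightarrow> two_sided \<eta> x \<noteq> two_sided \<eta> y"
    using b by (auto simp: halves_def)
  have w: "two_sided \<eta> (int x) = \<eta> x" if "x \<in> \<gamma>" for x using soliton_basic(4)[OF assms(1) that] by (rule two_sided_int)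
  have *: "adjacent U (int x) (int y)" if T: "finite T" "convex_in U T" "int x \<in> T" "int y \<in> T"
    "rank T (int x) = t" "rank T (int y) = Suc t" for T
  proof -
    obtain x0 where x0: "x0 \<in> T" "x0 < int y" "\<And>z. z \<in> T \<Longrightarrow> z < int y \<Longrightarrow> z \<le> x0"
        "rank T (int y) = Suc (rank T x0)"
      using rank_pred[OF T(1,4)] T(6) by (metis nat.distinct(1))
    then have "x0 = int x" using rank_inj[OF T(1) x0(1) T(3)] T by simp
    then show ?thesis using convex_adjacent[OF T(2,3,4)] x0 by simp
  qed
  have "int x \<in> P \<union> F" "int y \<in> P \<union> F" using x y G by auto
  then have "int x \<in> P \<and> int y \<in> P \<or> int x \<in> F \<and> int y \<in> F" using ne w x y by (metis Un_iff)
  then have adj: "adjacent U (int x) (int y)" using *[of P] *[of F] PF l x y by auto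
  then have xy: "x < y" by (simp add: adjacent_def)
  then obtain y' where y': "y = Suc y'" "x \<le> y'" by (cases y) auto
  have "xi \<eta> (Suc t) y' = xi \<eta> (Suc t) x"
  proof (rule xi_const[OF y'(2)])
    fix z assume z: "x < z" "z \<le> y'"
    have "level \<eta> (int z) < level \<eta> (int x)" by (rule transparent_level[OF g adj]) (use z y' in auto)
    then show "level \<eta> (int z) < enat (Suc t)" using x(3) by (auto intro: less_trans)
  qed
  then show ?thesis using y(3) unfolding y' by (simp add: xi_Suc del: of_nat_Suc)
qed

lemma soliton_cover:
  assumes "ts_uncrossed (two_sided \<eta>) U" "x \<ge> 1" "int x \<notin> U"
  shows "\<exists>k \<gamma>. soliton \<eta> k \<gamma> \<and> x \<in> \<gamma>"
  using assms
proof (induction)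
  case (cross U k G)
  show ?case
  proof (cases "int x \<in> G")
    case True
    \<comment> \<open>Sites \<open>\<le> 0\<close> always stay uncrossed, so \<open>G\<close> is the
      image of a set of naturals, as \<open>soliton\<close> demands.\<close>
    have "transparent \<eta> (U - G)" by (rule ts_uncrossed_good[OF \<eta> ts_uncrossed.cross[OF cross(1,2)]])
    have "G \<subseteq> {0..}"
    proof
      fix y assume "y \<in> G"
      then show "y \<in> {0..}" using transparent_nonpos[OF \<open>transparent \<eta> (U - G)\<close>, of y] by (cases "y \<le> 0") auto
    qed
    then have "int ` (nat ` G) = G" by (force simp: image_image)
    then have "soliton \<eta> k (nat ` G)" using cross(1,2) by (auto simp: soliton_def)
    moreover have "x \<in> nat ` G" using True by force
    ultimately show ?thesis by blast
  next
    case False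
    then show ?thesis using cross by simp
  qed
qed simp

section \<open>Records, slots and their counting function\<close>

lemma carrier_load_eq: "carrier_load \<eta> x = card {s. seats \<eta> x s}"
proof (induction x)
  case (Suc x)
  have f: "finite {s. seats \<eta> x s}" by (rule finite_seats)
  consider "\<eta> (Suc x) = 0" | "\<eta> (Suc x) = 1" using Omega_fin_values[OF \<eta>, of "Suc x"] by auto
  then show ?case
  proof cases
    case 1
    show ?thesis
    proof (cases "lowest False (seats \<eta> x)")
      case (enat s)
      have s: "s \<in> {s. seats \<eta> x s}" using enat by (simp add: lowest_eq_enat_iff)
      have "{t. seats \<eta> (Suc x) t} = {s. seats \<eta> x s} - {s}" using 1 fill_eq[OF enat] by auto
      moreover have "card {s. seats \<eta> x s} > 0" using s f by (metis card_gt_0_iff empty_iff)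
      ultimately show ?thesis using Suc 1 s f by (simp del: seats.simps)
    next
      case infinity
      then show ?thesis using Suc 1 fill_infinity[OF infinity] by (simp add: lowest_eq_infinity_iff)
    qed
  next
    case 2
    then obtain s where "level \<eta> (int (Suc x)) = enat s" by (rule level_one_finite)
    then have l: "lowest True (seats \<eta> x) = enat s" using 2 by (simp add: level_Suc del: of_nat_Suc)
    then have s: "s \<notin> {s. seats \<eta> x s}" by (simp add: lowest_eq_enat_iff)
    have "{t. seats \<eta> (Suc x) t} = insert s {s. seats \<eta> x s}" using 2 fill_eq[OF l] by auto
    then show ?thesis using Suc 2 s f by (simp del: seats.simps)
  qed
qed simp

text \<open>Infinite level means a 0 read by an empty carrier, and the load counts the occupied
  seats.\<close>

lemma record_site_iff: "x \<ge> 1 \<Longrightarrow> record_site \<eta> x \<longleftrightarrow> level \<eta> (int x) = \<infinity>"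
proof -
  assume "x \<ge> 1"
  then obtain y where y: "x = Suc y" by (cases x) auto
  have emp: "carrier_load \<eta> z = 0 \<longleftrightarrow> (\<forall>s. \<not> seats \<eta> z s)" for z
    using finite_seats by (simp add: carrier_load_eq)
  show ?thesis
  proof (cases "\<eta> x = 1")
    case True
    then obtain s where "level \<eta> (int (Suc y)) = enat s" using y level_one_finite by metis
    moreover have "\<not> record_site \<eta> x" using True y by (simp add: record_site_def)
    ultimately show ?thesis using y by simp
  next
    case False
    then have "\<eta> x = 0" using Omega_fin_values[OF \<eta> \<open>x \<ge> 1\<close>] by simp
    then have "record_site \<eta> x \<longleftrightarrow> carrier_load \<eta> y = 0" using y by (auto simp: record_site_def)
    then show ?thesis using False emp[of y] unfolding y level_Suc lowest_eq_infinity_iff by simp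
  qed
qed

text \<open>Termination leaves no uncrossed 1, so \<open>zero_prefix\<close> applies to every
  uncrossed site.\<close>

lemma final_uncrossed:
  obtains V where "ts_uncrossed (two_sided \<eta>) V" "transparent \<eta> V" "\<And>y. y \<in> V \<Longrightarrow> level \<eta> y = \<infinity>"
proof -
  obtain V where V: "ts_uncrossed (two_sided \<eta>) V" "\<forall>y\<in>V. two_sided \<eta> y \<noteq> 1"
    using ts_terminates[OF \<eta> ts_uncrossed.start] by blast
  have g: "transparent \<eta> V" by (rule ts_uncrossed_good[OF \<eta> V(1)])
  have "level \<eta> y = \<infinity>" if "y \<in> V" for y using zero_prefix[OF g _ that] V(2) by blast
  then show ?thesis using that V(1) g by blast
qed

lemma record_or_soliton: "x \<ge> 1 \<Longrightarrow> level \<eta> (int x) = \<infinity> \<or> (\<exists>k \<gamma>. soliton \<eta> k \<gamma> \<and> x \<in> \<gamma>)"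
  using final_uncrossed soliton_cover by metis

text \<open>The description has a witness because records and solitons cover all sites, and it is
  unique because every admissible value equals the level.\<close>

lemma slot_eq_level: "x \<ge> 1 \<Longrightarrow> slot \<eta> x = level \<eta> (int x)"
  unfolding slot_def
proof (rule the_equality, goal_cases)
  case 1
  show ?case
  proof (cases "level \<eta> (int x) = \<infinity>")
    case True
    then show ?thesis using 1 record_site_iff by simp
  next
    case False
    then obtain k \<gamma> where s: "soliton \<eta> k \<gamma>" "x \<in> \<gamma>" using record_or_soliton[OF 1] by auto
    obtain l where l: "1 \<le> l" "l \<le> k" "x = component \<gamma> l \<or> x = component \<gamma> (l + k)"
      using soliton_component[OF s] by blast
    then have "level \<eta> (int x) = enat (l - 1)" using component_level[OF s(1) l(1,2)] by auto
    then show ?thesis using s(1) l by blast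
  qed
next
  case (2 n)
  then show ?case using component_level record_site_iff by (elim disjE exE conjE) auto
qed

lemma xi_tilde_eq: "xi_tilde \<eta> k x = xi \<eta> k x"
  unfolding xi_tilde_def xi_def by (intro sum.cong) (auto simp: slot_eq_level)

text \<open>Makes the minimum in \<open>s_tilde\<close> meaningful: \<open>xi\<close> grows by at
  most 1 per site, and it is unbounded because infinitely many sites have level \<infinity>.\<close>

lemma xi_surj: "\<exists>x. xi \<eta> k x = i"
proof -
  obtain V where V: "transparent \<eta> V" "\<And>y. y \<in> V \<Longrightarrow> level \<eta> y = \<infinity>" using final_uncrossed by metis
  have up: "\<exists>y. xi \<eta> k y > xi \<eta> k x" for x
  proof -
    obtain y where y: "y \<in> V" "int x < y"
      using transparent_unbounded[OF V(1), of "int x"] by (metis (mono_tags, lifting) empty_Collect_eq finite.emptyI)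
    define z where "z = nat y - 1"
    have z: "y = int (Suc z)" "x \<le> z" using y(2) by (auto simp: z_def)
    have "xi \<eta> k (Suc z) = Suc (xi \<eta> k z)" using V(2)[OF y(1)] by (simp add: xi_Suc z(1) del: of_nat_Suc)
    then show ?thesis using xi_mono[OF z(2), of \<eta> k] by (intro exI[of _ "Suc z"]) simp
  qed
  show ?thesis
  proof (induction i)
    case (Suc i)
    then obtain x where x: "xi \<eta> k x = i" by blast
    \<comment> \<open>At the first site where \<open>xi\<close> reaches \<open>Suc i\<close>, unit
      increments prevent it from jumping past this value.\<close>
    let ?P = "\<lambda>y. Suc i \<le> xi \<eta> k y"
    have P: "?P (LEAST y. ?P y)" using up[of x] x by (metis LeastI_ex Suc_leI)
    then obtain y where y: "(LEAST y. ?P y) = Suc y" by (cases "LEAST y. ?P y") auto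
    then have "\<not> ?P y" using not_less_Least[of y ?P] by simp
    then have "xi \<eta> k (Suc y) = Suc i" using P y
      by (cases "enat k \<le> level \<eta> (int (Suc y))") (auto simp: xi_Suc simp del: of_nat_Suc)
    then show ?case by blast
  qed (use xi_0 in blast)
qed

text \<open>A Galois connection with the monotone function \<open>xi\<close>, which turns the
  intervals of the slot decomposition into level sets of \<open>xi\<close>.\<close>

lemma s_tilde_le_iff: "s_tilde \<eta> k i \<le> x \<longleftrightarrow> i \<le> xi \<eta> k x"
proof -
  let ?s = "LEAST x. xi \<eta> k x = i"
  have s: "xi \<eta> k ?s = i" using xi_surj by (rule LeastI_ex)
  have "?s \<le> x \<longleftrightarrow> i \<le> xi \<eta> k x"
  proof
    assume "?s \<le> x" then show "i \<le> xi \<eta> k x" using xi_mono[of ?s x \<eta> k] s by simp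
  next
    assume i: "i \<le> xi \<eta> k x"
    show "?s \<le> x"
    proof (rule ccontr)
      assume n: "\<not> ?s \<le> x"
      then have "xi \<eta> k x = i" using xi_mono[of x ?s \<eta> k] s i by simp
      then show False using n by (simp add: Least_le)
    qed
  qed
  then show ?thesis by (simp add: s_tilde_def xi_tilde_eq)
qed

text \<open>The interval is the set where \<open>xi \<eta> k\<close> equals \<open>i\<close>, and
  \<open>xi \<eta> k\<close> is constant on a \<open>k\<close>-soliton, so a single letter
  decides.\<close>

lemma soliton_interval_iff:
  assumes "soliton \<eta> k \<gamma>" "x \<in> \<gamma>"
  shows "\<gamma> \<subseteq> {s_tilde \<eta> k i ..< s_tilde \<eta> k (i + 1)} \<longleftrightarrow> xi \<eta> k x = i"
proof -
  have "y \<in> {s_tilde \<eta> k i ..< s_tilde \<eta> k (i + 1)} \<longleftrightarrow> xi \<eta> k y = i" for y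
    using s_tilde_le_iff[of k i y] s_tilde_le_iff[of k "i + 1" y] by auto
  then show ?thesis using soliton_xi_const[OF assms(1)] assms(2) by (metis subset_iff)
qed

section \<open>Solitons counted through their 1's at a given level\<close>

definition up_site :: "nat \<Rightarrow> nat set \<Rightarrow> nat" where
  "up_site t \<gamma> = (THE x. x \<in> \<gamma> \<and> \<eta> x = 1 \<and> level \<eta> (int x) = enat t)"

lemma up_site:
  assumes "soliton \<eta> k \<gamma>" "t < k"
  shows "up_site t \<gamma> \<in> \<gamma>" "\<eta> (up_site t \<gamma>) = 1" "level \<eta> (int (up_site t \<gamma>)) = enat t"
  using theI'[OF soliton_up_ex1[OF assms]] by (auto simp: up_site_def)

text \<open>A 1 at level \<open>t\<close> is no record, so it lies in exactly one soliton, whose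
  size exceeds \<open>t\<close>, and is the only such letter there. The bound \<open>N\<close> lets
  \<open>ups\<close> see all 1's.\<close>

lemma up_site_bij:
  assumes "\<And>x. \<eta> x = 1 \<Longrightarrow> x \<le> N"
  shows "bij_betw (up_site t) {\<gamma>. \<exists>j>t. soliton \<eta> j \<gamma> \<and> xi \<eta> k (up_site t \<gamma>) = i} (ups \<eta> N t k i)"
proof (intro bij_betw_imageI equalityI subsetI, rule inj_onI)
  fix \<gamma> \<delta> assume *: "\<gamma> \<in> {\<gamma>. \<exists>j>t. soliton \<eta> j \<gamma> \<and> xi \<eta> k (up_site t \<gamma>) = i}"
    "\<delta> \<in> {\<gamma>. \<exists>j>t. soliton \<eta> j \<gamma> \<and> xi \<eta> k (up_site t \<gamma>) = i}" "up_site t \<gamma> = up_site t \<delta>"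
  then obtain j l where jl: "j > t" "soliton \<eta> j \<gamma>" "l > t" "soliton \<eta> l \<delta>" by blast
  then show "\<gamma> = \<delta>" using soliton_disjoint(2)[OF jl(2,4) up_site(1)[OF jl(2,1)]] up_site(1)[OF jl(4,3)] *(3) by simp
next
  fix x assume "x \<in> up_site t ` {\<gamma>. \<exists>j>t. soliton \<eta> j \<gamma> \<and> xi \<eta> k (up_site t \<gamma>) = i}"
  then obtain \<gamma> j where x: "x = up_site t \<gamma>" and j: "j > t" and s: "soliton \<eta> j \<gamma>" and i: "xi \<eta> k x = i" by blast
  note u = up_site[OF s j]
  show "x \<in> ups \<eta> N t k i"
    using u assms[of x] soliton_basic(4)[OF s u(1)] i by (simp add: x ups_def)
next
  fix x assume x: "x \<in> ups \<eta> N t k i"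
  then have x': "x \<ge> 1" "level \<eta> (int x) = enat t" "\<eta> x = 1" by (auto simp: ups_def)
  then obtain j \<gamma> where s: "soliton \<eta> j \<gamma>" "x \<in> \<gamma>" using record_or_soliton[of x] by auto
  have j: "t < j" using soliton_basic(5)[OF s] x'(2) by simp
  have "up_site t \<gamma> = x" unfolding up_site_def
    by (rule the1_equality[OF soliton_up_ex1[OF s(1) j]]) (use s x' in simp)
  then show "x \<in> up_site t ` {\<gamma>. \<exists>j>t. soliton \<eta> j \<gamma> \<and> xi \<eta> k (up_site t \<gamma>) = i}"
    using s j x by (auto simp: ups_def)
qed

text \<open>Solitons of size larger than \<open>t\<close> have size \<open>Suc t\<close> or are
  larger still; the latter have a further 1 at level \<open>Suc t\<close>, met with
  \<open>xi\<close> raised by one. This is the balance in \<open>kkr_inv\<close> with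
  \<open>Suc t\<close>-solitons in place of the rows of length \<open>Suc t\<close>.\<close>

lemma zeta_tilde_ups:
  assumes N: "\<And>x. \<eta> x = 1 \<Longrightarrow> x \<le> N"
  shows "zeta_tilde \<eta> (Suc t) i + card (ups \<eta> N (Suc t) (Suc t) (Suc i)) = card (ups \<eta> N t (Suc t) i)"
proof -
  let ?k = "Suc t"
  define X where "X = {\<gamma>. \<exists>j>t. soliton \<eta> j \<gamma> \<and> xi \<eta> ?k (up_site t \<gamma>) = i}"
  define Y where "Y = {\<gamma>. \<exists>j>?k. soliton \<eta> j \<gamma> \<and> xi \<eta> ?k (up_site ?k \<gamma>) = Suc i}"
  define Z where "Z = {\<gamma>. soliton \<eta> ?k \<gamma> \<and> \<gamma> \<subseteq> {s_tilde \<eta> ?k i ..< s_tilde \<eta> ?k (i + 1)}}"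
  have Z: "Z = {\<gamma>. soliton \<eta> ?k \<gamma> \<and> xi \<eta> ?k (up_site t \<gamma>) = i}"
    unfolding Z_def using soliton_interval_iff[OF _ up_site(1)[of ?k _ t]] by blast
  have up: "xi \<eta> ?k (up_site ?k \<gamma>) = Suc (xi \<eta> ?k (up_site t \<gamma>))" if s: "soliton \<eta> j \<gamma>" and j: "j > ?k" for j \<gamma>
    using soliton_xi_Suc[OF s up_site[OF s] up_site[OF s]] j by simp
  \<comment> \<open>Passing back from level \<open>Suc t\<close> to level \<open>t\<close> describes
    \<open>Y\<close> by the same letter as \<open>X\<close> and \<open>Z\<close>, so that
    \<open>X\<close> splits as a disjoint union.\<close>
  have Y: "Y = {\<gamma>. \<exists>j>?k. soliton \<eta> j \<gamma> \<and> xi \<eta> ?k (up_site t \<gamma>) = i}"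
    unfolding Y_def by (intro Collect_cong ex_cong1 conj_cong refl) (simp only: up nat.inject)
  have bX: "bij_betw (up_site t) X (ups \<eta> N t ?k i)" unfolding X_def by (rule up_site_bij[OF N])
  have bY: "bij_betw (up_site ?k) Y (ups \<eta> N ?k ?k (Suc i))" unfolding Y_def by (rule up_site_bij[OF N])
  have "t < j \<longleftrightarrow> ?k < j \<or> j = ?k" for j by auto
  then have XYZ: "X = Y \<union> Z" unfolding X_def Y Z by auto
  moreover have "Y \<inter> Z = {}"
  proof (rule ccontr)
    assume "Y \<inter> Z \<noteq> {}"
    then obtain \<gamma> j where "j > ?k" "soliton \<eta> j \<gamma>" "soliton \<eta> ?k \<gamma>" unfolding Y Z by blast
    then show False using soliton_basic(2)[of j \<gamma>] soliton_basic(2)[of ?k \<gamma>] by simp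
  qed
  moreover have "finite X" using bij_betw_finite[OF bX] by simp
  ultimately have "card X = card Y + card Z" by (simp add: card_Un_disjoint)
  then show ?thesis using bij_betw_same_card[OF bX] bij_betw_same_card[OF bY]
    by (simp add: zeta_tilde_def Z_def)
qed

end

lemma count_mset_nth: "count (mset xs) v = card {j. 1 \<le> j \<and> j \<le> length xs \<and> xs ! (j - 1) = v}"
proof -
  have "{j. 1 \<le> j \<and> j \<le> length xs \<and> xs ! (j - 1) = v} = Suc ` {i. i < length xs \<and> v = xs ! i}"
    by (force simp: image_iff Suc_le_eq gr0_conv_Suc)
  then have "card {j. 1 \<le> j \<and> j \<le> length xs \<and> xs ! (j - 1) = v} = card {i. i < length xs \<and> v = xs ! i}"
    by (simp only: card_image inj_Suc)
  then show ?thesis by (simp only: count_mset count_list_eq_length_filter length_filter_conv_card)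
qed

theorem theorem2p2:
  fixes \<eta> :: "nat \<Rightarrow> nat" and \<mu> :: "nat multiset" and J :: "nat \<Rightarrow> int list" and k i :: nat
  assumes "\<eta> \<in> Omega_fin"
    and "kkr_limit \<eta> = (\<mu>, J)"
    and "k \<ge> 1"
  shows "zeta_tilde \<eta> k i = card {j. 1 \<le> j \<and> j \<le> count \<mu> k \<and> rig J k j = int i - int k}"
proof -
  obtain t where k: "k = Suc t" using assms(3) by (cases k) auto
  obtain M where M: "\<forall>x>M. \<eta> x = 0" using Omega_fin_bound[OF assms(1)] by blast
  obtain L where L: "\<And>x. x \<ge> L \<Longrightarrow> kkr \<eta> x = (\<mu>, J)"
    using kkr_eventually_limit[OF assms(1)] assms(2) by (auto simp: eventually_sequentially)
  \<comment> \<open>No 1 lies beyond \<open>N\<close>, and at \<open>N\<close> the KKR sequence has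
    reached its limit.\<close>
  define N where "N = max M L"
  have N: "x \<le> N" if "\<eta> x = 1" for x using M that by (cases "x > M") (auto simp: N_def)
  have inv: "kkr_inv \<eta> N (\<mu>, J)" using kkr_inv_kkr[of \<eta> N] L[of N] by (simp add: N_def)
  then have "count (mset (J k)) (int i - int k) + card (ups \<eta> N k k (Suc i)) = card (ups \<eta> N t k i)"
    unfolding k by (simp add: kkr_inv_def)
  \<comment> \<open>The same balance as for the riggings, with identical \<open>ups\<close> terms,
    so these cancel.\<close>
  moreover have "zeta_tilde \<eta> k i + card (ups \<eta> N k k (Suc i)) = card (ups \<eta> N t k i)"
    unfolding k by (rule zeta_tilde_ups[OF assms(1) N])
  moreover have "length (J k) = count \<mu> k" using inv by (simp add: kkr_inv_def)
  ultimately show ?thesis by (simp add: count_mset_nth rig_def)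
qed

end
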